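(* Let $q'=q^{q-1}$, let $\mathbf{s}=(s_1,\dots,s_r)$ with all $s_i\geq1$, let $\boldsymbol{\epsilon}=(\epsilon_1,\dots,\epsilon_r)\in(\mathbb{F}_q^\times)^r$, and let $\gamma_1,\dots,\gamma_r\in (A')^\times$ satisfy $\gamma_i^{q-1}=\epsilon_i$. Then in $\mathcal{A}_{k'}$ (via the embedding $\mathcal{A}_k\hookrightarrow\mathcal{A}_{k'}$) \[ \zeta_{\mathcal{A}_k}(\mathbf{s};\boldsymbol{\epsilon})=\frac{1}{\gamma_1\Gamma_{s_1}\cdots\gamma_r\Gamma_{s_r}}\sum_{\mathbf{j}\in\mathfrak{J}_{\mathbf{s}}}\theta^{\mathbf{j}}\,\mathrm{Li}_{\mathcal{A}_k,\mathbf{s}}(\gamma_1u_{s_1,j_1},\dots,\gamma_ru_{s_r,j_r}), \] and in particular the right-hand side lies in $\mathcal{A}_k$.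
   Context: Fix a prime $p$ and a power $q$ of $p$; $A=\mathbb{F}_q[\theta]$, $k=\mathbb{F}_q(\theta)$. For $n\geq1$, $[n]=\theta^{q^n}-\theta$, $D_n=[n]^{q^0}[n-1]^{q^1}\cdots[1]^{q^{n-1}}$, $L_n=(-1)^n[n]\cdots[1]$, $D_0=L_0=1$; for $n=\sum_j\alpha_jq^j$ ($0\leq\alpha_j<q$), $\Pi(n)=\prod_jD_j^{\alpha_j}$ and $\Gamma_{n+1}=\Pi(n)$. Anderson–Thakur polynomials: with $G_n(t,y)=\prod_{i=1}^n(t^{q^n}-y^{q^i})$, define $\mathfrak{H}_n(t,y)$ by $\sum_{n\geq0}\frac{\mathfrak{H}_n(t,y)}{\Gamma_{n+1}|_{\theta=t}}x^n=\left(1-\sum_{i\geq0}\frac{G_i(t,y)}{D_i|_{\theta=t}}x^{q^i}\right)^{-1}$, $H_n(t)=\mathfrak{H}_n(t,\theta)=\sum_{j=0}^{m_{n+1}}u_{n+1,j}t^j\in A[t]$ with $m_{n+1}=\deg_tH_n$. $\mathfrak{J}_{\mathbf{s}}=\{(j_1,\dots,j_r)\in\mathbb{N}^r:0\leq j_i\leq\deg_tH_{s_i-1}\}$, $\theta^{\mathbf{j}}=\theta^{j_1+\cdots+j_r}$. Let $\mathcal{A}_k=\prod_P A/(P)\,/\bigoplus_PA/(P)$, $P$ over monic irreducible polynomials of $A$ (a $k$-algebra). The alternating finite multiple zeta value $\zeta_{\mathcal{A}_k}(\mathbf{s};\boldsymbol{\epsilon})\in\mathcal{A}_k$ has $P$-component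 $\sum\frac{\epsilon_1^{\deg a_1}\cdots\epsilon_r^{\deg a_r}}{a_1^{s_1}\cdots a_r^{s_r}}\in A/(P)$, summed over monic $a_i\in A$ with $\deg P>\deg a_1>\cdots>\deg a_r\geq0$. Let $A'=\mathbb{F}_{q'}[\theta]$, $k'=\mathbb{F}_{q'}(\theta)$, $\mathcal{A}_{k'}=\prod_QA'/(Q)/\bigoplus_QA'/(Q)$ over monic irreducible $Q\in A'$; $\mathcal{A}_k$ embeds in $\mathcal{A}_{k'}$ by sending $(a_P)$ to $(b_Q)$ where $b_Q$ is the image of $a_P$ under $A/(P)\hookrightarrow A'/(Q)$ for the unique $P$ with $Q\mid P$. For $\mathbf{b}=((b_{Q,1}),\dots,(b_{Q,r}))\in\mathcal{A}_{k'}^r$, the finite Carlitz multiple polylogarithm $\mathrm{Li}_{\mathcal{A}_k,\mathbf{s}}(\mathbf{b})$ has $Q$-component $\sum_{\deg P>i_1>\cdots>i_r\geq0}\frac{b_{Q,1}^{q^{i_1}}\cdots b_{Q,r}^{q^{i_r}}}{L_{i_1}^{s_1}\cdots L_{i_r}^{s_r}}\in A'/(Q)$, where $P$ is the monic irreducible of $A$ divisible by $Q$. Elements of $A$ and $A'$ are viewed in $\mathcal{A}_{k'}$ diagonally. *)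

theory Defs
  imports
    "HOL-Library.Cardinality"
    "HOL-Algebra.QuotRing"
    "HOL-Algebra.Algebraic_Closure_Type"
    "HOL-Computational_Algebra.Computational_Algebra"
begin

text \<open>
  Throughout, the finite field with \<open>q\<close> elements is a type \<open>'a :: {finite, field}\<close>, so that
  \<open>q = CARD('a)\<close> is automatically a power of a prime, and \<open>A\<close> is the type \<open>'a poly\<close>, whose
  variable \<open>\<theta>\<close> is \<open>[:0, 1:]\<close>.
\<close>

section \<open>Carlitz factorials and Anderson--Thakur polynomials\<close>

definition theta :: "'a::{finite,field} poly" where
  "theta = [:0, 1:]"

definition bracket :: "nat \<Rightarrow> 'a::{finite,field} poly" where
  "bracket n = theta ^ (CARD('a) ^ n) - theta"

definition carlitz_D :: "nat \<Rightarrow> 'a::{finite,field} poly" where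
  "carlitz_D n = (\<Prod>i<n. bracket (n - i) ^ (CARD('a) ^ i))"

definition carlitz_L :: "nat \<Rightarrow> 'a::{finite,field} poly" where
  "carlitz_L n = (-1) ^ n * (\<Prod>i=1..n. bracket i)"

text \<open>
  The \<open>j\<close>-th base-\<open>q\<close> digit of \<open>n\<close> is \<open>n div q ^ j mod q\<close>; it vanishes for \<open>j > n\<close>.
\<close>

definition carlitz_Pi :: "nat \<Rightarrow> 'a::{finite,field} poly" where
  "carlitz_Pi n = (\<Prod>j\<le>n. carlitz_D j ^ (n div CARD('a) ^ j mod CARD('a)))"

text \<open>The Carlitz gamma function is only meant for positive arguments.\<close>

definition carlitz_Gamma :: "nat \<Rightarrow> 'a::{finite,field} poly" where
  "carlitz_Gamma n = carlitz_Pi (n - 1)"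

text \<open>
  The type \<open>'a poly poly\<close> is the ring of polynomials in an outer variable \<open>t\<close> whose coefficients
  are polynomials in an inner variable. The inner variable is \<open>y\<close>, and it is also \<open>\<theta>\<close>: the
  specialisation \<open>y = \<theta>\<close> merely renames it.
\<close>

definition var_t :: "'a::{finite,field} poly poly" where
  "var_t = [:0, 1:]"

definition var_y :: "'a::{finite,field} poly poly" where
  "var_y = [:[:0, 1:]:]"

definition at_t :: "'a::{finite,field} poly \<Rightarrow> 'a poly poly" where
  "at_t f = poly (map_poly (\<lambda>c. [:[:c:]:]) f) var_t"

definition AT_G :: "nat \<Rightarrow> 'a::{finite,field} poly poly" where
  "AT_G n = (\<Prod>i=1..n. var_t ^ (CARD('a) ^ n) - var_y ^ (CARD('a) ^ i))"

text \<open>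
  The power series in \<open>x\<close>, over the fraction field in \<open>t\<close> and \<open>y\<close>, that is inverted to form
  the generating series: the coefficient of \<open>x ^ m\<close> in the sum over \<open>i\<close> collects the
  (at most one) \<open>i\<close> with \<open>q ^ i = m\<close>.
\<close>

definition AT_series :: "'a::{finite,field} poly poly fract fps" where
  "AT_series = inverse (1 - Abs_fps (\<lambda>m. \<Sum>i | CARD('a) ^ i = m.
                  to_fract (AT_G i) / to_fract (at_t (carlitz_D i))))"

text \<open>
  \<open>AT_H n\<close> is the polynomial \<open>H\<^sub>n\<close>, characterised by \<open>H\<^sub>n / \<Gamma>\<^bsub>n+1\<^esub>(t)\<close> being the \<open>n\<close>-th
  coefficient of the generating series. As \<open>to_fract\<close> is injective, there is at most one such
  polynomial.
\<close>

definition AT_H :: "nat \<Rightarrow> 'a::{finite,field} poly poly" where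
  "AT_H n = (THE h. to_fract h / to_fract (at_t (carlitz_Gamma (n + 1))) = fps_nth AT_series n)"

definition AT_u :: "nat \<Rightarrow> nat \<Rightarrow> 'a::{finite,field} poly" where
  "AT_u n j = Polynomial.coeff (AT_H (n - 1)) j"

definition AT_J :: "'a::{finite,field} itself \<Rightarrow> nat list \<Rightarrow> nat list set" where
  "AT_J _ s = {js. length js = length s \<and>
                 (\<forall>i<length s. js ! i \<le> Polynomial.degree (AT_H (s ! i - 1) :: 'a poly poly))}"


section \<open>The rings \<open>\<A>\<^sub>k\<close>\<close>

definition monic_primes :: "'a::{finite,field} poly set" where
  "monic_primes = {P. Factorial_Ring.irreducible P \<and> Polynomial.lead_coeff P = 1}"

abbreviation poly_ring :: "'a::{finite,field} poly ring" where
  "poly_ring \<equiv> ring_of_type_algebra"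

definition resid_ring :: "'a::{finite,field} poly \<Rightarrow> 'a poly set ring" where
  "resid_ring P = poly_ring Quot (PIdl\<^bsub>poly_ring\<^esub> P)"

definition resid :: "'a::{finite,field} poly \<Rightarrow> 'a poly \<Rightarrow> 'a poly set" where
  "resid P a = (PIdl\<^bsub>poly_ring\<^esub> P) +>\<^bsub>poly_ring\<^esub> a"

definition prod_ring :: "'i set \<Rightarrow> ('i \<Rightarrow> 'c ring) \<Rightarrow> ('i \<Rightarrow> 'c) ring" where
  "prod_ring I R = \<lparr>
     carrier = (\<Pi>\<^sub>E i\<in>I. carrier (R i)),
     monoid.mult = (\<lambda>f g. \<lambda>i\<in>I. f i \<otimes>\<^bsub>R i\<^esub> g i),
     one = (\<lambda>i\<in>I. \<one>\<^bsub>R i\<^esub>),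
     ring.zero = (\<lambda>i\<in>I. \<zero>\<^bsub>R i\<^esub>),
     add = (\<lambda>f g. \<lambda>i\<in>I. f i \<oplus>\<^bsub>R i\<^esub> g i) \<rparr>"

definition direct_sum :: "'i set \<Rightarrow> ('i \<Rightarrow> 'c ring) \<Rightarrow> ('i \<Rightarrow> 'c) set" where
  "direct_sum I R = {f \<in> carrier (prod_ring I R). finite {i \<in> I. f i \<noteq> \<zero>\<^bsub>R i\<^esub>}}"

type_synonym 'a family = "'a poly \<Rightarrow> 'a poly set"

definition resid_prod :: "'a::{finite,field} family ring" where
  "resid_prod = prod_ring monic_primes resid_ring"

definition resid_sum :: "'a::{finite,field} family set" where
  "resid_sum = direct_sum monic_primes resid_ring"

definition fin_ring :: "'a::{finite,field} family set ring" where
  "fin_ring = resid_prod Quot resid_sum"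

definition fin_class :: "'a::{finite,field} family \<Rightarrow> 'a family set" where
  "fin_class f = resid_sum +>\<^bsub>resid_prod\<^esub> f"

definition fin_diag :: "'a::{finite,field} poly \<Rightarrow> 'a family set" where
  "fin_diag a = fin_class (\<lambda>P\<in>monic_primes. resid P a)"


section \<open>The embedding of \<open>\<A>\<^sub>k\<close> into \<open>\<A>\<^bsub>k'\<^esub>\<close>\<close>

text \<open>
  Here \<open>inc\<close> is the inclusion of the field with \<open>q\<close> elements into the one with \<open>q'\<close> elements. As for
  homomorphisms induced on quotients in \<^theory>\<open>HOL-Algebra.QuotRing\<close>, a map on cosets is given
  by \<open>the_elem\<close> of the (singleton) set of values at the representatives.
\<close>

definition below :: "('a::{finite,field} \<Rightarrow> 'b::{finite,field}) \<Rightarrow> 'b poly \<Rightarrow> 'a poly" where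
  "below inc Q = (THE P. P \<in> monic_primes \<and> Q dvd map_poly inc P)"

definition resid_embed ::
    "('a::{finite,field} \<Rightarrow> 'b::{finite,field}) \<Rightarrow> 'b poly \<Rightarrow> 'a poly set \<Rightarrow> 'b poly set" where
  "resid_embed inc Q C = the_elem ((\<lambda>a. resid Q (map_poly inc a)) ` C)"

definition fin_embed ::
    "('a::{finite,field} \<Rightarrow> 'b::{finite,field}) \<Rightarrow> 'a family set \<Rightarrow> 'b family set" where
  "fin_embed inc C =
     the_elem ((\<lambda>f. fin_class (\<lambda>Q\<in>monic_primes. resid_embed inc Q (f (below inc Q)))) ` C)"


section \<open>Alternating finite multiple zeta values and finite Carlitz multiple polylogarithms\<close>

definition fin_zeta_comp :: "nat list \<Rightarrow> 'a::{finite,field} list \<Rightarrow> 'a poly \<Rightarrow> 'a poly set" where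
  "fin_zeta_comp s \<epsilon> P =
     (let R = resid_ring P; r = length s in
      \<Oplus>\<^bsub>R\<^esub>as\<in>{as. length as = r \<and> (\<forall>a\<in>set as. Polynomial.lead_coeff a = 1) \<and>
                   sorted_wrt (>) (Polynomial.degree P # map Polynomial.degree as)}.
        (\<Otimes>\<^bsub>R\<^esub>i\<in>{..<r}. resid P [:\<epsilon> ! i:] [^]\<^bsub>R\<^esub> Polynomial.degree (as ! i))
        \<otimes>\<^bsub>R\<^esub> inv\<^bsub>R\<^esub> (\<Otimes>\<^bsub>R\<^esub>i\<in>{..<r}. resid P (as ! i) [^]\<^bsub>R\<^esub> (s ! i)))"

definition fin_zeta :: "nat list \<Rightarrow> 'a::{finite,field} list \<Rightarrow> 'a family set" where
  "fin_zeta s \<epsilon> = fin_class (\<lambda>P\<in>monic_primes. fin_zeta_comp s \<epsilon> P)"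

text \<open>Here \<open>x ! i\<close> is the component at \<open>Q\<close> of the \<open>i\<close>-th argument.\<close>

definition fin_Li_comp ::
    "('a::{finite,field} \<Rightarrow> 'b::{finite,field}) \<Rightarrow> nat list \<Rightarrow> 'b poly \<Rightarrow> 'b poly set list
      \<Rightarrow> 'b poly set" where
  "fin_Li_comp inc s Q x =
     (let R = resid_ring Q; r = length s in
      \<Oplus>\<^bsub>R\<^esub>d\<in>{d. length d = r \<and> sorted_wrt (>) (Polynomial.degree (below inc Q) # d)}.
        (\<Otimes>\<^bsub>R\<^esub>i\<in>{..<r}. (x ! i) [^]\<^bsub>R\<^esub> (CARD('a) ^ (d ! i)))
        \<otimes>\<^bsub>R\<^esub> inv\<^bsub>R\<^esub> (\<Otimes>\<^bsub>R\<^esub>i\<in>{..<r}.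
               resid Q (map_poly inc (carlitz_L (d ! i))) [^]\<^bsub>R\<^esub> (s ! i)))"

text \<open>
  The arguments are elements of \<open>\<A>\<^bsub>k'\<^esub>\<close>, that is, cosets. The set below consists of the values
  obtained from all choices of representing families, and it is a singleton.
\<close>

definition fin_Li ::
    "('a::{finite,field} \<Rightarrow> 'b::{finite,field}) \<Rightarrow> nat list \<Rightarrow> 'b family set list
      \<Rightarrow> 'b family set" where
  "fin_Li inc s B =
     the_elem ((\<lambda>f. fin_class (\<lambda>Q\<in>monic_primes. fin_Li_comp inc s Q (map (\<lambda>g. g Q) f)))
       ` {f. list_all2 (\<in>) f B})"

end

theory Submission
  imports Defs "HOL-Number_Theory.Cong"
begin

text \<open>
  With \<open>\<psi>\<^sub>d(z) = (\<Sum>i\<le>d. z ^ (q ^ i) / (D\<^sub>i L\<^bsub>d-i\<^esub> ^ (q ^ i)))\<close>, Carlitz's recursion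
  \<open>\<psi>\<^bsub>d+1\<^esub>(\<theta> z) = \<theta> \<psi>\<^bsub>d+1\<^esub>(z) + \<psi>\<^sub>d(z) ^ q\<close> shows that \<open>1 - \<psi>\<^sub>d\<close> vanishes exactly at the monic
  polynomials of degree \<open>d\<close>. Its logarithmic derivative is the generating series of the power sums
  \<open>S\<^sub>d(n) = \<Sum>a ^ (-n)\<close> over these polynomials. After rescaling \<open>z\<close> by \<open>L\<^sub>d\<close> it becomes the generating
  series of the Anderson--Thakur polynomials at \<open>t = \<theta>\<close>, \<open>y = \<theta> ^ (q ^ d)\<close>, so that
  \<open>\<Sum>\<^sub>j u\<^bsub>n,j\<^esub> ^ (q ^ d) \<theta> ^ j = \<Gamma>\<^sub>n L\<^sub>d ^ n S\<^sub>d(n)\<close>. The monic polynomials of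
  degree \<open>d\<close> and \<open>L\<^sub>d\<close> are invertible modulo every prime of degree greater than \<open>d\<close>, and
  \<open>\<gamma> ^ (q ^ d) = \<gamma> \<epsilon> ^ d\<close>; multiplying these identities over the depth gives the claim modulo every
  prime that does not divide the \<open>\<Gamma>\<^bsub>s\<^sub>i\<^esub>\<close>.
\<close>

section \<open>Frobenius maps\<close>

lemma card_field_ge_2: "CARD('a::{finite,field}) \<ge> 2"
proof -
  have "card {0, 1 :: 'a} \<le> CARD('a)"
    by (rule card_mono) auto
  then show ?thesis
    by simp
qed

lemma card_field_gt_1 [simp]: "CARD('a::{finite,field}) > Suc 0"
  using card_field_ge_2[where 'a='a] by simp

text \<open>Multiplication by a nonzero \<open>x\<close> permutes the nonzero elements; cancelling
  their product gives \<open>x ^ (q - 1) = 1\<close>.\<close>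

lemma finite_field_power_card:
  fixes x :: "'a::{finite,field}"
  shows "x ^ CARD('a) = x"
proof (cases "x = 0")
  case True
  then show ?thesis by (simp add: power_0_left)
next
  case False
  have "bij_betw ((*) x) (UNIV - {0}) (UNIV - {0})"
    using False by (intro bij_betwI[where g = "\<lambda>y. y / x"]) auto
  then have "(\<Prod>y\<in>UNIV - {0}. x * y) = \<Prod>(UNIV - {0})"
    by (rule prod.reindex_bij_betw)
  moreover have "(\<Prod>y\<in>UNIV - {0::'a}. y) \<noteq> 0"
    by simp
  ultimately have "x ^ (CARD('a) - 1) = 1"
    by (simp add: prod.distrib card_Diff_singleton)
  moreover have "x ^ CARD('a) = x * x ^ (CARD('a) - 1)"
    by (metis card_field_ge_2 le_trans one_le_numeral power_eq_if zero_less_one not_one_le_zero)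
  ultimately show ?thesis
    by simp
qed

lemma finite_field_power_card_power:
  fixes x :: "'a::{finite,field}"
  shows "x ^ (CARD('a) ^ n) = x"
  by (induction n) (simp_all add: power_mult finite_field_power_card)

text \<open>
  The polynomial \<open>(X + 1) ^ q - X ^ q - 1\<close> has degree less than \<open>q\<close> and vanishes on the whole
  field.
\<close>
lemma of_nat_card_choose_eq_0:
  assumes "0 < i" "i < CARD('a)"
  shows "of_nat (CARD('a) choose i) = (0::'a::{finite,field})"
proof -
  let ?q = "CARD('a)"
  define f :: "'a poly" where "f = (\<Sum>k\<in>{0<..<?q}. monom (of_nat (?q choose k)) k)"
  have split: "{..?q} = insert 0 (insert ?q {0<..<?q})"
    using card_field_ge_2[where 'a='a] by auto
  have "poly f x = 0" for x
  proof -
    have "x + 1 = (x + 1) ^ ?q"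
      by (simp add: finite_field_power_card)
    also have "\<dots> = (\<Sum>k\<le>?q. of_nat (?q choose k) * x ^ k)"
      by (simp add: binomial_ring)
    also have "\<dots> = 1 + (x ^ ?q + poly f x)"
      unfolding split using card_field_ge_2[where 'a='a]
      by (simp add: f_def poly_sum poly_monom)
    finally show ?thesis
      by (simp add: finite_field_power_card)
  qed
  moreover have "degree f < ?q"
    unfolding f_def using card_field_ge_2[where 'a='a]
    by (intro degree_sum_less) (auto intro: le_less_trans[OF degree_monom_le])
  ultimately have "f = 0"
    using card_poly_roots_bound[of f] by (metis (mono_tags, lifting) UNIV_def iso_tuple_UNIV_I leD Collect_cong)
  then have "coeff f i = 0"
    by simp
  then show ?thesis
    using assms by (simp add: f_def coeff_sum sum.delta)
qed

text \<open>Phrased through vanishing binomial coefficients so that it applies alike to polynomials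
  and to their fractions.\<close>

lemma power_card_add:
  fixes x y :: "'c::comm_ring_1"
  assumes "\<And>i. 0 < i \<Longrightarrow> i < CARD('a) \<Longrightarrow> of_nat (CARD('a) choose i) = (0::'c)"
  shows "(x + y) ^ CARD('a::{finite,field}) = x ^ CARD('a) + y ^ CARD('a)"
proof -
  let ?q = "CARD('a)"
  have split: "{..?q} = insert 0 (insert ?q {0<..<?q})"
    using card_field_ge_2[where 'a='a] by auto
  have "(x + y) ^ ?q = (\<Sum>k\<le>?q. of_nat (?q choose k) * x ^ k * y ^ (?q - k))"
    by (rule binomial_ring)
  also have "\<dots> = y ^ ?q + x ^ ?q"
    unfolding split using card_field_ge_2[where 'a='a] by (simp add: assms)
  finally show ?thesis
    by simp
qed

lemma poly_of_nat_card_choose_eq_0: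
  assumes "0 < i" "i < CARD('a)"
  shows "of_nat (CARD('a) choose i) = (0::'a::{finite,field} poly)"
  using of_nat_card_choose_eq_0[OF assms] by (metis of_nat_poly pCons_0_0)

lemma to_fract_of_nat: "to_fract (of_nat n) = of_nat n"
  by (induction n) simp_all

lemma to_fract_power: "to_fract (x ^ n) = to_fract x ^ n"
  by (induction n) simp_all

lemma to_fract_prod: "to_fract (prod f A) = (\<Prod>x\<in>A. to_fract (f x))"
  by (induction A rule: infinite_finite_induct) simp_all

lemma fract_of_nat_card_choose_eq_0:
  assumes "0 < i" "i < CARD('a)"
  shows "of_nat (CARD('a) choose i) = (0::'a::{finite,field} poly fract)"
  using poly_of_nat_card_choose_eq_0[OF assms] by (metis to_fract_of_nat to_fract_0)

lemma poly_frobenius_add: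
  fixes x y :: "'a::{finite,field} poly"
  shows "(x + y) ^ (CARD('a) ^ n) = x ^ (CARD('a) ^ n) + y ^ (CARD('a) ^ n)"
  by (induction n arbitrary: x y)
     (simp_all add: power_mult power_card_add poly_of_nat_card_choose_eq_0)

lemma fract_frobenius_add:
  fixes x y :: "'a::{finite,field} poly fract"
  shows "(x + y) ^ (CARD('a) ^ n) = x ^ (CARD('a) ^ n) + y ^ (CARD('a) ^ n)"
  by (induction n arbitrary: x y)
     (simp_all add: power_mult power_card_add fract_of_nat_card_choose_eq_0)

lemma poly_frobenius_diff:
  fixes x y :: "'a::{finite,field} poly"
  shows "(x - y) ^ (CARD('a) ^ n) = x ^ (CARD('a) ^ n) - y ^ (CARD('a) ^ n)"
  using poly_frobenius_add[of "x - y" y n] by (simp add: algebra_simps)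

lemma fract_frobenius_sum:
  fixes f :: "'i \<Rightarrow> 'a::{finite,field} poly fract"
  shows "(\<Sum>i\<in>A. f i) ^ (CARD('a) ^ n) = (\<Sum>i\<in>A. f i ^ (CARD('a) ^ n))"
  by (induction A rule: infinite_finite_induct) (simp_all add: fract_frobenius_add power_0_left)

text \<open>Since \<open>q choose 1 = q\<close>, the vanishing of the binomial coefficients gives
  \<open>q = 0\<close>. This will kill the derivative of \<open>z ^ (q ^ i)\<close> for
  \<open>i > 0\<close>.\<close>

lemma fract_of_nat_card_power_eq_0:
  assumes "i > 0"
  shows "of_nat (CARD('a) ^ i) = (0::'a::{finite,field} poly fract)"
proof -
  have "of_nat CARD('a) = (0::'a poly fract)"
    using fract_of_nat_card_choose_eq_0[of 1, where 'a='a] card_field_ge_2[where 'a='a] by simp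
  then show ?thesis
    using assms by (simp add: power_0_left)
qed

section \<open>Carlitz polynomials\<close>

lemma bracket_0 [simp]: "bracket 0 = 0"
  by (simp add: bracket_def)

lemma degree_theta_power [simp]: "degree (theta ^ n) = n"
  by (simp add: theta_def degree_power_eq)

lemma theta_power_eq_iff [simp]: "(theta::'a::{finite,field} poly) ^ m = theta ^ n \<longleftrightarrow> m = n"
  by (metis degree_theta_power)

lemma bracket_eq_0_iff [simp]: "(bracket n :: 'a::{finite,field} poly) = 0 \<longleftrightarrow> n = 0"
  using theta_power_eq_iff[of "CARD('a) ^ n" 1, where 'a='a] card_field_ge_2[where 'a='a]
  by (auto simp: bracket_def)

lemma carlitz_D_0 [simp]: "carlitz_D 0 = 1"
  by (simp add: carlitz_D_def)

lemma carlitz_D_Suc: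
  "(carlitz_D (Suc n) :: 'a::{finite,field} poly) = bracket (Suc n) * carlitz_D n ^ CARD('a)"
  by (simp add: carlitz_D_def prod.lessThan_Suc_shift prod_power_distrib power_mult mult.commute
        flip: power_mult del: prod.lessThan_Suc)

lemma carlitz_L_0 [simp]: "carlitz_L 0 = 1"
  by (simp add: carlitz_L_def)

lemma carlitz_L_Suc: "carlitz_L (Suc n) = - bracket (Suc n) * carlitz_L n"
  by (simp add: carlitz_L_def)

lemma carlitz_D_neq_0 [simp]: "carlitz_D n \<noteq> 0"
  by (induction n) (simp_all add: carlitz_D_Suc)

lemma carlitz_L_neq_0 [simp]: "carlitz_L n \<noteq> 0"
  by (induction n) (simp_all add: carlitz_L_Suc)

section \<open>Carlitz's linear polynomials and their values at powers of
  \<open>theta\<close>\<close>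

definition psi_coeff :: "nat \<Rightarrow> nat \<Rightarrow> 'a::{finite,field} poly fract" where
  "psi_coeff d i = 1 / (to_fract (carlitz_D i) * to_fract (carlitz_L (d - i)) ^ (CARD('a) ^ i))"

text \<open>This is Carlitz's \<open>e\<^sub>d(z) / D\<^sub>d\<close>, where
  \<open>e\<^sub>d(z)\<close> is the product of \<open>z - a\<close> over \<open>a = 0\<close> and
  all \<open>a\<close> of degree less than \<open>d\<close>; the expanded form makes the linearity
  over the finite field visible.\<close>

definition psi :: "nat \<Rightarrow> 'a::{finite,field} poly fract \<Rightarrow> 'a poly fract" where
  "psi d z = (\<Sum>i\<le>d. psi_coeff d i * z ^ (CARD('a) ^ i))"

lemma psi_0 [simp]: "psi 0 z = z"
  by (simp add: psi_def psi_coeff_def)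

lemma to_fract_bracket:
  "to_fract (bracket n :: 'a::{finite,field} poly) = to_fract theta ^ (CARD('a) ^ n) - to_fract theta"
  by (simp add: bracket_def to_fract_power)

lemma bracket_mult_psi_coeff_Suc:
  "to_fract (bracket (Suc i)) * psi_coeff (Suc d) (Suc i)
     = (psi_coeff d i :: 'a::{finite,field} poly fract) ^ CARD('a)"
  by (simp add: psi_coeff_def carlitz_D_Suc to_fract_power power_divide power_mult_distrib
        flip: power_mult) (simp add: mult.commute)

text \<open>Passing from \<open>z\<close> to \<open>theta * z\<close> multiplies the
  \<open>i\<close>-th term by \<open>theta ^ (q ^ i)\<close>, so the difference carries the factor
  \<open>bracket i\<close>. The term \<open>i = 0\<close> drops out, and the others are the
  \<open>q\<close>-th powers of the terms of \<open>psi d z\<close>.\<close>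

lemma psi_theta_mult:
  "psi (Suc d) (to_fract theta * z) = to_fract theta * psi (Suc d) z + psi d z ^ CARD('a)"
  for z :: "'a::{finite,field} poly fract"
proof -
  have "psi (Suc d) (to_fract theta * z) - to_fract theta * psi (Suc d) z
      = (\<Sum>i\<le>Suc d. to_fract (bracket i) * psi_coeff (Suc d) i * z ^ (CARD('a) ^ i))"
    by (simp only: psi_def sum_distrib_left sum_subtractf[symmetric] to_fract_bracket)
       (simp add: algebra_simps power_mult_distrib)
  also have "\<dots> = (\<Sum>i\<le>d. (psi_coeff d i * z ^ (CARD('a) ^ i)) ^ CARD('a))"
    by (simp add: sum.atMost_Suc_shift bracket_mult_psi_coeff_Suc power_mult_distrib
         flip: power_mult del: sum.atMost_Suc) (simp add: mult.commute)
  also have "\<dots> = psi d z ^ CARD('a)"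
    using fract_frobenius_sum[of _ "{..d}" 1, where 'a='a] by (simp add: psi_def)
  finally show ?thesis
    by (simp add: algebra_simps)
qed

text \<open>Insert \<open>theta ^ (q ^ i)\<close> between the two terms of \<open>bracket d\<close>;
  the first difference is a \<open>q ^ i\<close>-th power.\<close>

lemma bracket_diff_frobenius:
  assumes "i \<le> d"
  shows "bracket d = (bracket (d - i) :: 'a::{finite,field} poly) ^ (CARD('a) ^ i) + bracket i"
  using assms by (simp add: bracket_def poly_frobenius_diff flip: power_mult power_add)

lemma bracket_power_mult_psi_coeff:
  assumes "i \<le> d"
  shows "to_fract (bracket (Suc d - i)) ^ (CARD('a) ^ i) * psi_coeff (Suc d) i
      = - (psi_coeff d i :: 'a::{finite,field} poly fract)"
proof -
  \<comment> \<open>Additivity of Frobenius at \<open>1 + (- 1)\<close> gives this sign for odd and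
    even \<open>q\<close> alike.\<close>
  have "(- 1 :: 'a poly fract) ^ (CARD('a) ^ i) = - 1"
    using fract_frobenius_add[of 1 "- 1 :: 'a poly fract" i] by (simp add: power_0_left add_eq_0_iff)
  then have "(- x :: 'a poly fract) ^ (CARD('a) ^ i) = - (x ^ (CARD('a) ^ i))" for x
    by (metis power_mult_distrib mult_minus1)
  then show ?thesis
    using assms
    by (simp add: psi_coeff_def Suc_diff_le carlitz_L_Suc power_mult_distrib)
qed

text \<open>Multiply by \<open>bracket (Suc d)\<close> and split it in the \<open>i\<close>-th term
  by \<open>bracket_diff_frobenius\<close>. The two halves sum to \<open>- psi d 1\<close> and
  \<open>psi d 1 ^ q\<close>, which cancel because \<open>psi d 1\<close> is \<open>1\<close> for
  \<open>d = 0\<close> and \<open>0\<close> otherwise.\<close>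

lemma psi_1_eq_0: "psi (Suc d) 1 = (0 :: 'a::{finite,field} poly fract)"
proof (induction d rule: less_induct)
  case (less d)
  have "to_fract (bracket (Suc d)) * psi (Suc d) 1
      = (\<Sum>i\<le>Suc d. to_fract (bracket (Suc d - i)) ^ (CARD('a) ^ i) * psi_coeff (Suc d) i)
        + (\<Sum>i\<le>Suc d. to_fract (bracket i) * (psi_coeff (Suc d) i :: 'a poly fract))"
    unfolding psi_def sum_distrib_left sum.distrib[symmetric]
    by (intro sum.cong refl, subst bracket_diff_frobenius)
       (auto simp: algebra_simps to_fract_power simp flip: to_fract_power)
  also have "(\<Sum>i\<le>Suc d. to_fract (bracket (Suc d - i)) ^ (CARD('a) ^ i) * psi_coeff (Suc d) i)
     = - (psi d 1 :: 'a poly fract)"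
    by (simp add: bracket_power_mult_psi_coeff psi_def sum_negf power_0_left)
  also have "(\<Sum>i\<le>Suc d. to_fract (bracket i) * (psi_coeff (Suc d) i :: 'a poly fract))
     = psi d 1 ^ CARD('a)"
    using fract_frobenius_sum[of _ "{..d}" 1, where 'a='a]
    by (simp add: psi_def sum.atMost_Suc_shift bracket_mult_psi_coeff_Suc del: sum.atMost_Suc)
  also have "- psi d 1 + psi d (1 :: 'a poly fract) ^ CARD('a) = 0"
    using less.IH[of "d - 1"] by (cases d) (auto simp: power_0_left)
  finally show ?case
    by simp
qed

text \<open>In the induction step \<open>psi_theta_mult\<close> leaves two terms:
  \<open>theta * psi d (theta ^ m)\<close> vanishes since \<open>m < d\<close>, and the other one
  lowers both indices by one.\<close>

lemma psi_theta_power: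
  "m \<le> d \<Longrightarrow> psi d (to_fract theta ^ m) = (if m = d then 1 else 0 :: 'a::{finite,field} poly fract)"
proof (induction m arbitrary: d)
  case 0
  then show ?case
    by (cases d) (auto simp: psi_1_eq_0)
next
  case (Suc m)
  then obtain e where "d = Suc e"
    by (cases d) auto
  with Suc show ?case
    by (simp add: psi_theta_mult power_0_left)
qed

lemma psi_add: "psi d (x + y) = psi d x + psi d y"
  by (simp add: psi_def fract_frobenius_add algebra_simps sum.distrib)

lemma psi_zero [simp]: "psi d 0 = 0"
  by (simp add: psi_def power_0_left)

lemma psi_sum: "psi d (sum f A) = (\<Sum>x\<in>A. psi d (f x))"
  by (induction A rule: infinite_finite_induct) (simp_all add: psi_add)

lemma psi_const_mult: "psi d (to_fract [:c:] * x) = to_fract [:c:] * psi d x"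
proof -
  have "to_fract [:c:] ^ (CARD('a) ^ i) = to_fract [:c:]" for i and c :: 'a
    by (simp add: poly_const_pow finite_field_power_card_power flip: to_fract_power)
  then show ?thesis
    by (simp add: psi_def power_mult_distrib sum_distrib_left mult_ac)
qed

section \<open>The monic polynomials of degree \<open>d\<close> as the roots of
  \<open>1 - psi_poly d\<close>\<close>

definition monics :: "nat \<Rightarrow> 'a::{finite,field} poly set" where
  "monics d = {a. degree a = d \<and> lead_coeff a = 1}"

text \<open>By linearity over the finite field only the leading power of \<open>theta\<close>
  contributes.\<close>

lemma psi_monic:
  assumes "a \<in> monics d"
  shows "psi d (to_fract a) = 1"
proof -
  have a: "degree a = d" "coeff a d = 1"
    using assms by (auto simp: monics_def)
  have "to_fract a = (\<Sum>m\<le>d. to_fract [:coeff a m:] * to_fract theta ^ m)"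
    using poly_as_sum_of_monoms[of a]
    by (simp add: a monom_altdef theta_def flip: to_fract_power to_fract_mult to_fract_sum)
  then have "psi d (to_fract a) = (\<Sum>m\<le>d. to_fract [:coeff a m:] * psi d (to_fract theta ^ m))"
    by (simp add: psi_sum psi_const_mult)
  also have "\<dots> = (\<Sum>m\<le>d. if m = d then to_fract [:coeff a m:] else 0)"
    by (intro sum.cong) (auto simp: psi_theta_power)
  also have "\<dots> = 1"
    using a by (simp flip: one_pCons)
  finally show ?thesis .
qed

lemma monics_0 [simp]: "monics 0 = {1}"
  by (auto simp: monics_def elim!: degree_eq_zeroE)

lemma monics_Suc: "monics (Suc d) = (\<lambda>(c, a). pCons c a) ` (UNIV \<times> monics d)"
proof (intro equalityI subsetI)
  fix a :: "'a poly" assume "a \<in> monics (Suc d)"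
  then show "a \<in> (\<lambda>(c, a). pCons c a) ` (UNIV \<times> monics d)"
    by (cases a) (auto simp: monics_def image_iff split: if_splits)
qed (auto simp: monics_def)

lemma finite_monics [simp]: "finite (monics d)"
  by (induction d) (auto simp: monics_Suc)

lemma card_monics: "card (monics d :: 'a::{finite,field} poly set) = CARD('a) ^ d"
proof (induction d)
  case (Suc d)
  have "inj_on (\<lambda>(c, a). pCons c a) (UNIV \<times> monics d :: ('a \<times> 'a poly) set)"
    by (auto intro: inj_onI)
  with Suc show ?case
    by (simp add: monics_Suc card_image)
qed simp

lemma monics_neq_0: "a \<in> monics d \<Longrightarrow> a \<noteq> 0"
  by (auto simp: monics_def)

definition psi_poly :: "nat \<Rightarrow> 'a::{finite,field} poly fract poly" where
  "psi_poly d = (\<Sum>i\<le>d. monom (psi_coeff d i) (CARD('a) ^ i))"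

lemma poly_psi_poly: "poly (psi_poly d) z = psi d z"
  by (simp add: psi_poly_def psi_def poly_sum poly_monom)

text \<open>By \<open>psi_monic\<close> both sides vanish at the \<open>q ^ d\<close> monic
  polynomials of degree \<open>d\<close>. Both have degree at most \<open>q ^ d\<close> and the same
  coefficient there, so a nonzero difference would have more roots than its degree allows.\<close>

lemma psi_poly_factor:
  "1 - psi_poly d
     = smult (- 1 / to_fract (carlitz_D d)) (\<Prod>a\<in>monics d. [:- to_fract a, 1 :: 'a::{finite,field} poly fract:])"
    (is "?F = smult ?c ?P")
proof -
  let ?N = "CARD('a) ^ d"
  have "[:- to_fract a, 1 :: 'a poly fract:] \<noteq> 0" for a
    by simp
  then have deg: "degree ?P = ?N"
    by (subst degree_prod_eq_sum_degree) (auto simp: card_monics)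
  have "lead_coeff ?P = 1"
    by (simp add: lead_coeff_prod)
  then have leadP: "coeff ?P ?N = 1"
    by (simp only: deg)
  have inj: "CARD('a) ^ i = CARD('a) ^ j \<longleftrightarrow> i = j" for i j
    by (simp add: power_inject_exp)
  have "coeff (psi_poly d) ?N = (\<Sum>i\<le>d. if i = d then psi_coeff d i else 0 :: 'a poly fract)"
    by (simp add: psi_poly_def coeff_sum inj)
  then have leadF: "coeff ?F ?N = ?c"
    by (simp add: psi_coeff_def)
  have "degree (psi_poly d :: 'a poly fract poly) \<le> ?N"
    unfolding psi_poly_def using card_field_ge_2[where 'a='a]
    by (intro degree_sum_le) (auto intro!: order_trans[OF degree_monom_le] power_increasing)
  then have "degree (1 :: 'a poly fract poly) \<le> ?N" "degree (psi_poly d :: 'a poly fract poly) \<le> ?N"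
    by auto
  then have degF: "degree ?F \<le> ?N"
    by (rule degree_diff_le)
  define R where "R = ?F - smult ?c ?P"
  have "degree R \<le> ?N"
    unfolding R_def using deg by (intro degree_diff_le[OF degF]) auto
  moreover have "coeff R ?N = 0"
    unfolding R_def coeff_diff[of ?F "smult ?c ?P"] coeff_smult leadF leadP by simp
  ultimately have degR: "degree R < ?N \<or> R = 0"
    by (metis leading_coeff_0_iff le_neq_implies_less)
  have roots: "poly R x = 0" if "x \<in> to_fract ` monics d" for x
    using that by (auto simp: R_def poly_psi_poly psi_monic poly_prod)
  have "R = 0"
  proof (rule ccontr)
    assume "R \<noteq> 0"
    then have "card (to_fract ` monics d :: 'a poly fract set) \<le> degree R"
      using roots
      by (intro order_trans[OF card_mono card_poly_roots_bound]) (auto simp: poly_roots_finite)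
    also have "card (to_fract ` monics d :: 'a poly fract set) = ?N"
      by (subst card_image) (auto simp: card_monics inj_on_def)
    finally show False
      using degR \<open>R \<noteq> 0\<close> by auto
  qed
  then show ?thesis
    unfolding R_def by (simp only: right_minus_eq)
qed

text \<open>Evaluate the factorisation at \<open>0\<close>. Thus \<open>D\<^sub>d\<close> is a
  common multiple of the monic polynomials of degree \<open>d\<close>, and no prime of larger degree
  divides it.\<close>

lemma carlitz_D_eq_prod_monics: "carlitz_D d = (\<Prod>a\<in>monics d. a :: 'a::{finite,field} poly)"
proof -
  have "(- 1 :: 'a poly fract) ^ (CARD('a) ^ d) = - 1"
    using fract_frobenius_add[of 1 "- 1 :: 'a poly fract" d] by (simp add: power_0_left add_eq_0_iff)
  moreover have "poly (1 - psi_poly d) (0 :: 'a poly fract) = 1"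
    by (simp add: poly_psi_poly)
  ultimately have "1 = to_fract (\<Prod>a\<in>monics d. a :: 'a poly) / to_fract (carlitz_D d)"
    unfolding psi_poly_factor
    by (simp add: poly_prod prod_uminus card_monics to_fract_prod)
  then show ?thesis
    by (simp add: field_simps)
qed

text \<open>As \<open>q ^ i = 0\<close> in the field for \<open>i > 0\<close>, only the linear term
  survives.\<close>

lemma pderiv_psi_poly:
  "pderiv (psi_poly d) = [:1 / to_fract (carlitz_L d) :: 'a::{finite,field} poly fract:]"
proof -
  have "pderiv (psi_poly d) = (\<Sum>i\<le>d. pderiv (monom (psi_coeff d i :: 'a poly fract) (CARD('a) ^ i)))"
    using higher_pderiv_sum[of 1] by (simp add: psi_poly_def)
  also have "\<dots> = (\<Sum>i\<le>d. if i = 0 then [:psi_coeff d 0:] else 0)"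
    by (intro sum.cong) (auto simp: pderiv_monom fract_of_nat_card_power_eq_0 monom_0 simp del: of_nat_power)
  finally show ?thesis
    by (simp add: psi_coeff_def)
qed

section \<open>Power sums over monic polynomials\<close>

definition power_sum :: "nat \<Rightarrow> nat \<Rightarrow> 'a::{finite,field} poly fract" where
  "power_sum d m = (\<Sum>a\<in>monics d. 1 / to_fract a ^ m)"

text \<open>Multiplication by the geometric series of \<open>1 / (a - z)\<close> removes the factor
  at \<open>a\<close> up to sign, so by the product rule the left side is minus the derivative of
  \<open>1 - psi_poly d\<close>. The shift \<open>Suc n\<close> comes from the coefficient
  \<open>1 / a ^ Suc n\<close> of this series.\<close>

lemma psi_poly_mult_power_sum_series:
  "fps_of_poly (1 - psi_poly d) * Abs_fps (\<lambda>n. power_sum d (Suc n))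
     = fps_const (1 / to_fract (carlitz_L d) :: 'a::{finite,field} poly fract)"
proof -
  let ?c = "- 1 / to_fract (carlitz_D d) :: 'a poly fract"
  let ?l = "\<lambda>a::'a poly. [:- to_fract a, 1:]"
  let ?g = "\<lambda>a::'a poly. Abs_fps (\<lambda>n. 1 / to_fract a ^ Suc n)"
  have g: "fps_of_poly (?l a) * ?g a = - 1" if "a \<in> monics d" for a
  proof (rule fps_ext)
    fix n show "(fps_of_poly (?l a) * ?g a) $ n = (- 1 :: 'a poly fract fps) $ n"
      using monics_neq_0[OF that]
      by (cases n) (simp_all add: fps_of_poly_pCons algebra_simps)
  qed
  have G: "Abs_fps (\<lambda>n. power_sum d (Suc n)) = (\<Sum>a\<in>monics d. ?g a)"
    by (rule fps_ext) (simp add: power_sum_def fps_sum_nth)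
  have "fps_of_poly (1 - psi_poly d) * Abs_fps (\<lambda>n. power_sum d (Suc n))
      = (\<Sum>a\<in>monics d. fps_of_poly (1 - psi_poly d) * ?g a)"
    by (simp only: G sum_distrib_left)
  also have "\<dots> = (\<Sum>a\<in>monics d. - fps_of_poly (smult ?c (\<Prod>b\<in>monics d - {a}. ?l b)))"
  proof (rule sum.cong)
    fix a :: "'a poly" assume a: "a \<in> monics d"
    have "1 - psi_poly d = smult ?c (\<Prod>b\<in>monics d - {a}. ?l b) * ?l a"
      unfolding psi_poly_factor by (subst prod.remove[OF _ a]) (auto simp: mult.commute)
    then show "fps_of_poly (1 - psi_poly d) * ?g a = - fps_of_poly (smult ?c (\<Prod>b\<in>monics d - {a}. ?l b))"
      by (simp only: fps_of_poly_mult mult.assoc g[OF a]) simp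
  qed auto
  also have "\<dots> = - fps_of_poly (pderiv (1 - psi_poly d))"
    unfolding psi_poly_factor pderiv_smult pderiv_prod fps_of_poly_smult fps_of_poly_sum
    by (simp add: pderiv_pCons sum_negf sum_distrib_left)
  also have "\<dots> = fps_const (1 / to_fract (carlitz_L d))"
    by (simp add: pderiv_diff pderiv_psi_poly)
  finally show ?thesis .
qed

lemma power_sum_1: "power_sum d (Suc 0) = 1 / to_fract (carlitz_L d)"
  using arg_cong[OF psi_poly_mult_power_sum_series[of d], of "\<lambda>f. f $ 0"]
  by (simp add: psi_poly_def coeff_sum)

text \<open>For \<open>n > 0\<close> the constant series has coefficient zero. The specialised
  Anderson--Thakur polynomials will satisfy the same recursion after rescaling.\<close>

lemma power_sum_Suc:
  assumes "n > 0"
  shows "power_sum d (Suc n)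
    = (\<Sum>i | i \<le> d \<and> CARD('a) ^ i \<le> n. psi_coeff d i * power_sum d (Suc (n - CARD('a) ^ i))
         :: 'a::{finite,field} poly fract)"
proof -
  let ?G = "Abs_fps (\<lambda>n. power_sum d (Suc n)) :: 'a poly fract fps"
  have "(fps_of_poly (psi_poly d) * ?G) $ n
     = (\<Sum>i\<le>d. (fps_const (psi_coeff d i) * fps_X ^ (CARD('a) ^ i) * ?G) $ n)"
    by (simp add: psi_poly_def fps_of_poly_sum fps_of_poly_monom sum_distrib_right fps_sum_nth)
  also have "\<dots> = (\<Sum>i\<le>d. if CARD('a) ^ i \<le> n then psi_coeff d i * power_sum d (Suc (n - CARD('a) ^ i)) else 0)"
    by (intro sum.cong) (auto simp: mult.assoc fps_X_power_mult_nth)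
  also have "\<dots> = (\<Sum>i | i \<le> d \<and> CARD('a) ^ i \<le> n. psi_coeff d i * power_sum d (Suc (n - CARD('a) ^ i)))"
    by (subst sum.inter_filter[symmetric]) (auto intro!: sum.cong)
  also have "(fps_of_poly (psi_poly d) * ?G) $ n = power_sum d (Suc n)"
    using arg_cong[OF psi_poly_mult_power_sum_series[where 'a='a, of d], of "\<lambda>f. f $ n"] assms
    by (simp add: fps_of_poly_diff left_diff_distrib)
  finally show ?thesis .
qed

section \<open>Carlitz factorials\<close>

lemma less_card_power: "n < CARD('a::{finite,field}) ^ n"
  by (rule power_gt_expt) (use card_field_ge_2[where 'a='a] in simp)

lemma finite_card_power_le: "finite {i. CARD('a::{finite,field}) ^ i \<le> n}"
  by (rule finite_subset[of _ "{..n}"])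
     (use less_card_power[where 'a='a] in \<open>auto intro: order_trans less_imp_le\<close>)

text \<open>Digits beyond position \<open>n\<close> vanish; a common range \<open>N\<close> allows
  factorials to be compared digit by digit.\<close>

lemma carlitz_Pi_eq_prod:
  assumes "n \<le> N"
  shows "carlitz_Pi n = (\<Prod>j\<le>N. carlitz_D j ^ (n div CARD('a) ^ j mod CARD('a)) :: 'a::{finite,field} poly)"
proof -
  have "n div CARD('a) ^ j = 0" if "j > n" for j
  proof -
    have "n < CARD('a) ^ j"
      using less_trans[OF that less_card_power] .
    then show ?thesis by simp
  qed
  then show ?thesis
    unfolding carlitz_Pi_def using assms by (intro prod.mono_neutral_left) auto
qed

lemma carlitz_Pi_0 [simp]: "carlitz_Pi 0 = 1"
  by (simp add: carlitz_Pi_def)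

lemma carlitz_Pi_neq_0 [simp]: "carlitz_Pi n \<noteq> 0"
  by (simp add: carlitz_Pi_def)

text \<open>No carry occurs: for \<open>j < i\<close> the summand is a multiple of
  \<open>q ^ Suc j\<close>, and for \<open>j > i\<close> the quotient by \<open>q ^ j\<close> does
  not change.\<close>

lemma digit_add_power:
  fixes q :: nat
  assumes "q \<ge> 2" "m div q ^ i mod q < q - 1"
  shows "(m + q ^ i) div q ^ j mod q = m div q ^ j mod q + (if j = i then 1 else 0)"
proof (cases j i rule: linorder_cases)
  case less
  then obtain k where k: "i = Suc (j + k)"
    using less_imp_Suc_add by blast
  have "q ^ i = q ^ j * (q * q ^ k)"
    by (simp add: k power_add mult_ac)
  then have "(m + q ^ i) div q ^ j = m div q ^ j + q * q ^ k"
    using assms by simp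
  with less show ?thesis
    by simp
next
  case equal
  have "(m + q ^ i) div q ^ i mod q = Suc (m div q ^ i) mod q"
    using assms by simp
  also have "\<dots> = Suc (m div q ^ i mod q)"
    using assms by (simp add: mod_Suc)
  finally show ?thesis
    using equal by simp
next
  case greater
  then obtain k where k: "j = Suc (i + k)"
    using less_imp_Suc_add by blast
  \<comment> \<open>The digit is at most \<open>q - 2\<close>, so its successor does not reach the
    next multiple of \<open>q\<close>.\<close>
  have "Suc (m div q ^ i) mod q \<noteq> 0"
    using assms by (simp add: mod_Suc)
  then have "(m + q ^ i) div q ^ i div q = m div q ^ i div q"
    using assms by (simp add: div_Suc)
  moreover have "q ^ j = q ^ i * (q * q ^ k)"
    by (simp add: k power_add mult_ac)
  ultimately have "(m + q ^ i) div q ^ j = m div q ^ j"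
    by (simp add: div_mult2_eq)
  with greater show ?thesis
    by simp
qed

lemma carlitz_Pi_add_no_carry:
  assumes "m div CARD('a) ^ i mod CARD('a) < CARD('a) - 1"
  shows "carlitz_Pi (m + CARD('a) ^ i) = carlitz_D i * (carlitz_Pi m :: 'a::{finite,field} poly)"
proof -
  define N where "N = m + CARD('a) ^ i"
  have "i \<le> N"
    using less_card_power[of i, where 'a='a] by (simp add: N_def)
  have "carlitz_Pi (m + CARD('a) ^ i)
      = (\<Prod>j\<le>N. (if j = i then carlitz_D i else 1) * carlitz_D j ^ (m div CARD('a) ^ j mod CARD('a)) :: 'a poly)"
    using digit_add_power[OF card_field_ge_2 assms]
    by (subst carlitz_Pi_eq_prod[of _ N]) (auto simp: N_def intro!: prod.cong)
  also have "\<dots> = carlitz_D i * carlitz_Pi m"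
    using \<open>i \<le> N\<close> by (subst carlitz_Pi_eq_prod[of m N]) (auto simp: N_def prod.distrib)
  finally show ?thesis .
qed

lemma carlitz_Pi_add_multiple:
  assumes "m div CARD('a) ^ i mod CARD('a) = 0" "k < CARD('a)"
  shows "carlitz_Pi (m + k * CARD('a) ^ i) = carlitz_D i ^ k * (carlitz_Pi m :: 'a::{finite,field} poly)"
  using assms(2)
proof (induction k)
  case (Suc k)
  have "(m + k * CARD('a) ^ i) div CARD('a) ^ i mod CARD('a) = k"
    using mod_add_left_eq[of "m div CARD('a) ^ i" "CARD('a)" k] assms(1) Suc.prems
    by (simp add: add.commute)
  then have "carlitz_Pi (m + k * CARD('a) ^ i + CARD('a) ^ i)
      = carlitz_D i * (carlitz_Pi (m + k * CARD('a) ^ i) :: 'a poly)"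
    using Suc.prems by (intro carlitz_Pi_add_no_carry) auto
  with Suc show ?case
    by (simp add: algebra_simps)
qed simp

text \<open>Recovers, in the carry case below, that taking \<open>q - 1\<close> away from a digit
  \<open>q - 1\<close> leaves the digit \<open>0\<close>.\<close>

lemma mod_add_pred_eq_pred_iff:
  fixes q :: nat
  assumes "q > 0"
  shows "(x + (q - 1)) mod q = q - 1 \<longleftrightarrow> x mod q = 0"
proof (cases "x mod q = 0")
  case False
  have "x mod q < q"
    using assms by simp
  have "(x + (q - 1)) mod q = ((x mod q - 1) + q) mod q"
    using False assms by (subst mod_add_left_eq[symmetric]) simp
  also have "\<dots> = x mod q - 1"
    using \<open>x mod q < q\<close> by (simp add: less_imp_diff_less)
  finally show ?thesis
    using False \<open>x mod q < q\<close> by linarith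
next
  case True
  have "(x + (q - 1)) mod q = (x mod q + (q - 1)) mod q"
    by (simp only: mod_add_left_eq)
  also have "\<dots> = q - 1"
    using assms True by simp
  finally show ?thesis
    using True by simp
qed

text \<open>
  Adding \<open>q ^ i\<close> to \<open>m\<close> either increases the \<open>i\<close>-th digit by one or, if that digit is \<open>q - 1\<close>,
  replaces it by \<open>0\<close> and carries; the carry is harmless as \<open>D\<^sub>i ^ q\<close> divides \<open>D\<^bsub>i+1\<^esub>\<close>.
\<close>
lemma carlitz_D_mult_Pi_dvd:
  "carlitz_D i * carlitz_Pi m dvd (carlitz_Pi (m + CARD('a) ^ i) :: 'a::{finite,field} poly)"
proof (induction m arbitrary: i rule: less_induct)
  case (less m)
  let ?q = "CARD('a)"
  show ?case
  proof (cases "m div ?q ^ i mod ?q < ?q - 1")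
    case True
    then show ?thesis
      by (simp add: carlitz_Pi_add_no_carry)
  next
    case False
    have q: "?q \<ge> 2"
      by (rule card_field_ge_2)
    have "m div ?q ^ i mod ?q < ?q"
      using q by simp
    with False have digit: "m div ?q ^ i mod ?q = ?q - 1"
      by linarith
    define m' where "m' = m - (?q - 1) * ?q ^ i"
    have "(?q - 1) * ?q ^ i \<le> m div ?q ^ i * ?q ^ i"
      using digit mod_less_eq_dividend[of "m div ?q ^ i" ?q] by (intro mult_right_mono) auto
    also have "\<dots> \<le> m"
      by simp
    finally have m: "m = m' + (?q - 1) * ?q ^ i"
      by (simp add: m'_def)
    have "m div ?q ^ i = m' div ?q ^ i + (?q - 1)"
      using q by (simp add: m)
    then have "(m' div ?q ^ i + (?q - 1)) mod ?q = ?q - 1"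
      using digit by simp
    then have "m' div ?q ^ i mod ?q = 0"
      using q mod_add_pred_eq_pred_iff[of ?q "m' div ?q ^ i"] by linarith
    then have "carlitz_D i * (carlitz_Pi m :: 'a poly) = carlitz_D i ^ ?q * carlitz_Pi m'"
      using q unfolding m
      by (subst carlitz_Pi_add_multiple) (auto simp: power_eq_if[of _ ?q])
    also have "\<dots> dvd carlitz_D (Suc i) * carlitz_Pi m'"
      by (intro mult_dvd_mono) (auto simp: carlitz_D_Suc)
    \<comment> \<open>The carry may propagate, so the induction hypothesis is applied to
      \<open>m' < m\<close> at position \<open>Suc i\<close>.\<close>
    also have "\<dots> dvd carlitz_Pi (m' + ?q ^ Suc i)"
      using q by (intro less.IH) (simp add: m)
    also have "m' + ?q ^ Suc i = m + ?q ^ i"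
      using q by (simp add: m mult_eq_if[of ?q])
    finally show ?thesis .
  qed
qed

text \<open>This divisibility makes the recursion for the Anderson--Thakur polynomials
  integral.\<close>

lemma carlitz_Pi_diff_dvd:
  assumes "CARD('a) ^ i \<le> n"
  shows "carlitz_D i * carlitz_Pi (n - CARD('a) ^ i) dvd (carlitz_Pi n :: 'a::{finite,field} poly)"
  using carlitz_D_mult_Pi_dvd[of i "n - CARD('a) ^ i", where 'a='a] assms by simp

section \<open>Anderson--Thakur polynomials\<close>

text \<open>Evaluation, constants, Frobenius powers and coefficientwise maps all have this form, so
  the specialisations arise by composition and share one set of transport rules.\<close>

locale semiring_hom =
  fixes h :: "'c::comm_semiring_1 \<Rightarrow> 'd::comm_semiring_1"
  assumes zero: "h 0 = 0" and one: "h 1 = 1"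
    and add: "h (x + y) = h x + h y" and mult: "h (x * y) = h x * h y"
begin

lemma sum: "h (sum f A) = (\<Sum>x\<in>A. h (f x))"
  by (induction A rule: infinite_finite_induct) (simp_all add: zero add)

lemma prod: "h (prod f A) = (\<Prod>x\<in>A. h (f x))"
  by (induction A rule: infinite_finite_induct) (simp_all add: one mult)

lemma power: "h (x ^ n) = h x ^ n"
  by (induction n) (simp_all add: one mult)

lemma map_poly_hom: "semiring_hom (map_poly h)"
proof
  show "map_poly h (p * q) = map_poly h p * map_poly h q" for p q
    by (rule poly_eqI) (simp add: coeff_map_poly zero coeff_mult sum mult)
qed (simp_all add: poly_eq_iff coeff_map_poly zero one add)

end

lemma semiring_hom_poly: "semiring_hom (\<lambda>p. poly p x)"
  by unfold_locales auto

lemma semiring_hom_comp: "semiring_hom g \<Longrightarrow> semiring_hom h \<Longrightarrow> semiring_hom (\<lambda>x. g (h x))"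
  by (simp add: semiring_hom_def)

lemma semiring_hom_const: "semiring_hom (\<lambda>c. [:c:])"
  by unfold_locales (simp_all add: one_pCons mult.commute)

lemma semiring_hom_frobenius: "semiring_hom (\<lambda>x :: 'a::{finite,field} poly. x ^ (CARD('a) ^ n))"
  by unfold_locales (auto simp: poly_frobenius_add power_mult_distrib power_0_left)

lemma semiring_hom_at_t: "semiring_hom (at_t :: 'a::{finite,field} poly \<Rightarrow> 'a poly poly)"
proof -
  have "semiring_hom (\<lambda>f. poly (map_poly (\<lambda>c::'a. [:[:c:]:]) f) var_t)"
    by (intro semiring_hom_comp[OF semiring_hom_poly] semiring_hom.map_poly_hom
        semiring_hom_comp[OF semiring_hom_const] semiring_hom_const)
  then show ?thesis
    by (simp add: at_t_def[abs_def])
qed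

text \<open>
  The specialisation \<open>t = \<theta>\<close>, \<open>y = \<theta> ^ (q ^ d)\<close>; it turns \<open>\<HH>\<^sub>n(t, y)\<close> into the value at
  \<open>t = \<theta>\<close> of the \<open>d\<close>-th twist of \<open>H\<^sub>n\<close>.
\<close>
definition twist_eval :: "nat \<Rightarrow> 'a::{finite,field} poly poly \<Rightarrow> 'a poly" where
  "twist_eval d h = poly (map_poly (\<lambda>x. x ^ (CARD('a) ^ d)) h) theta"

lemma semiring_hom_twist_eval: "semiring_hom (twist_eval d)"
  unfolding twist_eval_def[abs_def]
  by (intro semiring_hom_comp[OF semiring_hom_poly] semiring_hom.map_poly_hom semiring_hom_frobenius)

interpretation at_t: semiring_hom at_t
  by (rule semiring_hom_at_t)

interpretation twist_eval: semiring_hom "twist_eval d" for d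
  by (rule semiring_hom_twist_eval)

lemma at_t_pCons: "at_t (pCons c f) = [:[:c:]:] + var_t * at_t f"
  by (simp add: at_t_def map_poly_pCons)

lemma twist_eval_var_t [simp]: "twist_eval d var_t = theta"
  by (simp add: twist_eval_def var_t_def map_poly_pCons)

lemma twist_eval_const: "twist_eval d [:x:] = (x :: 'a::{finite,field} poly) ^ (CARD('a) ^ d)"
  by (simp add: twist_eval_def map_poly_pCons power_0_left)

text \<open>The coefficients of \<open>at_t f\<close> come from the finite field and are fixed by
  Frobenius, so only \<open>t = \<theta>\<close> takes effect. In particular \<open>at_t\<close> is
  injective.\<close>

lemma twist_eval_at_t [simp]: "twist_eval d (at_t f) = f"
proof (induction f)
  case 0
  then show ?case
    by (simp add: at_t.zero twist_eval.zero)
next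
  case (pCons c f)
  then show ?case
    by (simp add: at_t_pCons twist_eval.add twist_eval.mult twist_eval_const poly_const_pow
        finite_field_power_card_power theta_def)
qed

lemma at_t_neq_0: "f \<noteq> 0 \<Longrightarrow> at_t f \<noteq> 0"
  by (metis twist_eval_at_t twist_eval.zero)

lemma twist_eval_diff: "twist_eval d (x - y) = twist_eval d x - twist_eval d y"
  using twist_eval.add[of d "x - y" y] by simp

lemma twist_eval_AT_G:
  "twist_eval d (AT_G i :: 'a::{finite,field} poly poly) = (\<Prod>l=1..i. theta ^ (CARD('a) ^ i) - theta ^ (CARD('a) ^ (d + l)))"
  by (simp add: AT_G_def twist_eval.prod twist_eval_diff twist_eval.power var_y_def twist_eval_const
      theta_def power_add flip: power_mult)

lemma carlitz_L_add: "carlitz_L (m + i) = (\<Prod>l=1..i. - bracket (m + l)) * carlitz_L m"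
  by (induction i) (simp_all add: carlitz_L_Suc)

text \<open>For \<open>i \<le> d\<close> the \<open>q ^ i\<close>-th powers of the top
  \<open>i\<close> factors of \<open>L\<^sub>d\<close> are the factors of the specialised
  \<open>AT_G i\<close>. For \<open>i > d\<close> a factor vanishes, which matches the truncation of
  \<open>psi d\<close>.\<close>

lemma to_fract_twist_eval_AT_G:
  "to_fract (twist_eval d (AT_G i :: 'a poly poly))
     = (if i \<le> d then psi_coeff d i * to_fract (carlitz_L d) ^ (CARD('a) ^ i) * to_fract (carlitz_D i)
        else 0 :: 'a::{finite,field} poly fract)"
proof (cases "i \<le> d")
  case True
  let ?Q = "CARD('a) ^ i"
  have "(carlitz_L d :: 'a poly) ^ ?Q
      = (\<Prod>l=1..i. (theta - theta ^ (CARD('a) ^ (d - i + l))) ^ ?Q) * carlitz_L (d - i) ^ ?Q"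
    using carlitz_L_add[of "d - i" i, where 'a='a] True
    by (simp add: power_mult_distrib prod_power_distrib bracket_def)
  also have "(\<Prod>l=1..i. (theta - theta ^ (CARD('a) ^ (d - i + l))) ^ ?Q) = twist_eval d (AT_G i :: 'a poly poly)"
    unfolding twist_eval_AT_G using True
    by (intro prod.cong refl) (simp add: poly_frobenius_diff flip: power_mult power_add)
  finally show ?thesis
    using True by (simp add: psi_coeff_def to_fract_power flip: to_fract_power[of "carlitz_L d"])
next
  case False
  then have "twist_eval d (AT_G i :: 'a poly poly) = 0"
    \<comment> \<open>The factor at \<open>l = i - d\<close> is zero because
      \<open>d + l = i\<close>.\<close>
    unfolding twist_eval_AT_G by (intro prod_zero bexI[of _ "i - d"]) auto
  with False show ?thesis
    by simp
qed

section \<open>The generating series and the integrality of its rescaled coefficients\<close>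

lemma AT_series_0 [simp]: "fps_nth AT_series 0 = 1"
  by (simp add: AT_series_def card_field_ge_2)

lemma AT_series_nth:
  assumes "n > 0"
  shows "fps_nth AT_series n = (\<Sum>i | CARD('a) ^ i \<le> n.
     to_fract (AT_G i) / to_fract (at_t (carlitz_D i :: 'a::{finite,field} poly))
       * fps_nth AT_series (n - CARD('a) ^ i))"
proof -
  let ?c = "\<lambda>i. to_fract (AT_G i) / to_fract (at_t (carlitz_D i :: 'a poly))"
  let ?B = "Abs_fps (\<lambda>m. \<Sum>i | CARD('a) ^ i = m. ?c i)"
  \<comment> \<open>As \<open>q ^ i\<close> is never \<open>0\<close>, the inverted series has
    constant term \<open>1\<close>, and its formal inverse is a true one.\<close>
  have "?B $ 0 = 0"
    by simp
  then have "(1 - ?B) * AT_series = 1"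
    unfolding AT_series_def by (subst mult.commute, intro inverse_mult_eq_1) simp
  then have "(AT_series :: 'a poly poly fract fps) = 1 + ?B * AT_series"
    by (simp add: left_diff_distrib algebra_simps)
  then have "fps_nth AT_series n = (?B * AT_series) $ n"
    using assms by (subst (asm) fps_eq_iff) (simp add: fps_one_nth)
  also have "\<dots> = (\<Sum>m\<le>n. \<Sum>i | CARD('a) ^ i = m. ?c i * AT_series $ (n - m))"
    by (simp add: fps_mult_nth sum_distrib_right atMost_atLeast0)
  \<comment> \<open>Restricting \<open>i\<close> to the finite set with \<open>q ^ i \<le> n\<close>
    lets the fibres over \<open>m\<close> be merged into one sum.\<close>
  also have "\<dots> = (\<Sum>m\<le>n. \<Sum>i | i \<in> {i. CARD('a) ^ i \<le> n} \<and> CARD('a) ^ i = m. ?c i * AT_series $ (n - CARD('a) ^ i))"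
    by (intro sum.cong) auto
  also have "\<dots> = (\<Sum>i | CARD('a) ^ i \<le> n. ?c i * AT_series $ (n - CARD('a) ^ i))"
    by (rule sum.group) (use finite_card_power_le[of n, where 'a='a] in auto)
  finally show ?thesis .
qed

text \<open>For \<open>q ^ i \<le> n\<close> this division is exact, by
  \<open>carlitz_Pi_diff_dvd\<close>.\<close>

definition Pi_quot :: "nat \<Rightarrow> nat \<Rightarrow> 'a::{finite,field} poly" where
  "Pi_quot n i = carlitz_Pi n div (carlitz_D i * carlitz_Pi (n - CARD('a) ^ i))"

lemma carlitz_Pi_eq_Pi_quot_mult:
  assumes "CARD('a) ^ i \<le> n"
  shows "carlitz_Pi n = Pi_quot n i * carlitz_D i * (carlitz_Pi (n - CARD('a) ^ i) :: 'a::{finite,field} poly)"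
  using carlitz_Pi_diff_dvd[OF assms] by (simp add: Pi_quot_def mult.assoc)

lemma AT_series_mult_at_t_Pi:
  assumes "n > 0"
  shows "fps_nth AT_series n * to_fract (at_t (carlitz_Pi n :: 'a::{finite,field} poly))
    = (\<Sum>i | CARD('a) ^ i \<le> n. to_fract (at_t (Pi_quot n i) * AT_G i)
        * (fps_nth AT_series (n - CARD('a) ^ i) * to_fract (at_t (carlitz_Pi (n - CARD('a) ^ i)))))"
  unfolding AT_series_nth[OF assms] sum_distrib_right
  by (intro sum.cong refl, subst carlitz_Pi_eq_Pi_quot_mult[of _ n])
     (auto simp: at_t.mult at_t_neq_0)

text \<open>Justifies the description in \<open>AT_H\<close>: existence is a strong induction along
  the integral recursion, and uniqueness is injectivity of \<open>to_fract\<close>.\<close>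

lemma to_fract_AT_H:
  "to_fract (AT_H n) = fps_nth AT_series n * to_fract (at_t (carlitz_Pi n :: 'a::{finite,field} poly))"
proof -
  have "\<exists>h. to_fract h = fps_nth AT_series n * to_fract (at_t (carlitz_Pi n :: 'a poly))"
  proof (induction n rule: less_induct)
    case (less n)
    show ?case
    proof (cases "n = 0")
      case True
      then show ?thesis
        by (auto simp: at_t.one intro: exI[of _ 1])
    next
      case False
      from less obtain g where g: "\<And>m. m < n \<Longrightarrow>
          to_fract (g m) = fps_nth AT_series m * to_fract (at_t (carlitz_Pi m :: 'a poly))"
        by metis
      show ?thesis
        using False
        by (intro exI[of _ "\<Sum>i | CARD('a) ^ i \<le> n. at_t (Pi_quot n i) * AT_G i * g (n - CARD('a) ^ i)"])
           (simp add: AT_series_mult_at_t_Pi g)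
    qed
  qed
  then obtain h where h: "to_fract h = fps_nth AT_series n * to_fract (at_t (carlitz_Pi n :: 'a poly))"
    by blast
  have "to_fract g / to_fract (at_t (carlitz_Gamma (n + 1) :: 'a poly)) = fps_nth AT_series n
      \<longleftrightarrow> g = h" for g
    unfolding to_fract_eq_iff[symmetric, of g h] h
    by (simp add: carlitz_Gamma_def at_t_neq_0 divide_eq_eq del: to_fract_eq_iff)
  then have "AT_H n = h"
    unfolding AT_H_def by (simp only: the_eq_trivial)
  with h show ?thesis
    by simp
qed

lemma AT_H_0 [simp]: "AT_H 0 = 1"
proof -
  have "to_fract (AT_H 0) = (to_fract 1 :: 'a poly poly fract)"
    unfolding to_fract_AT_H by (simp add: at_t.one)
  then show ?thesis
    by (simp only: to_fract_eq_iff)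
qed

lemma AT_H_rec:
  assumes "n > 0"
  shows "AT_H n = (\<Sum>i | CARD('a) ^ i \<le> n. at_t (Pi_quot n i) * AT_G i
       * (AT_H (n - CARD('a) ^ i) :: 'a::{finite,field} poly poly))"
proof -
  have "to_fract (AT_H n) = to_fract (\<Sum>i | CARD('a) ^ i \<le> n. at_t (Pi_quot n i) * AT_G i
       * (AT_H (n - CARD('a) ^ i) :: 'a poly poly))"
    by (simp add: to_fract_AT_H AT_series_mult_at_t_Pi[OF assms])
  then show ?thesis
    by (simp only: to_fract_eq_iff)
qed

text \<open>Both sides satisfy the same recursion in \<open>n\<close>. The specialised
  \<open>AT_G i\<close> contributes \<open>psi_coeff d i\<close>, the missing power of
  \<open>L\<^sub>d\<close>, and the \<open>D\<^sub>i\<close> that completes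
  \<open>Pi_quot n i\<close> to the factorial; it vanishes for \<open>i > d\<close>.\<close>

lemma twist_eval_AT_H:
  "to_fract (twist_eval d (AT_H n))
     = to_fract (carlitz_Pi n) * to_fract (carlitz_L d) ^ Suc n
       * (power_sum d (Suc n) :: 'a::{finite,field} poly fract)"
proof (induction n rule: less_induct)
  case (less n)
  let ?L = "to_fract (carlitz_L d) :: 'a poly fract"
  show ?case
  proof (cases "n = 0")
    case True
    then show ?thesis
      by (simp add: twist_eval.one power_sum_1)
  next
    case False
    let ?I = "{i. CARD('a) ^ i \<le> n}" and ?m = "\<lambda>i. n - CARD('a) ^ i"
    have "to_fract (twist_eval d (AT_H n))
        = (\<Sum>i\<in>?I. to_fract (Pi_quot n i) * to_fract (twist_eval d (AT_G i))
            * to_fract (twist_eval d (AT_H (?m i))) :: 'a poly fract)"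
      using False by (simp add: AT_H_rec twist_eval.sum twist_eval.mult)
    also have "\<dots> = (\<Sum>i\<in>?I. if i \<le> d then to_fract (carlitz_Pi n) * ?L ^ Suc n
            * (psi_coeff d i * power_sum d (Suc (?m i))) else 0)"
    proof (rule sum.cong)
      fix i assume i: "i \<in> ?I"
      have "to_fract (twist_eval d (AT_H (?m i)))
        = to_fract (carlitz_Pi (?m i)) * ?L ^ Suc (?m i) * power_sum d (Suc (?m i))"
        using False i by (intro less.IH) auto
      moreover have "?L ^ Suc n = ?L ^ (CARD('a) ^ i) * ?L ^ Suc (?m i)"
        using i by (simp only: power_add[symmetric]) simp
      moreover have "to_fract (carlitz_Pi n)
          = to_fract (Pi_quot n i) * to_fract (carlitz_D i) * to_fract (carlitz_Pi (?m i) :: 'a poly)"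
        using i by (subst carlitz_Pi_eq_Pi_quot_mult[of i n]) auto
      ultimately show "to_fract (Pi_quot n i) * to_fract (twist_eval d (AT_G i))
            * to_fract (twist_eval d (AT_H (?m i)))
          = (if i \<le> d then to_fract (carlitz_Pi n) * ?L ^ Suc n
            * (psi_coeff d i * power_sum d (Suc (?m i))) else 0)"
        by (simp add: to_fract_twist_eval_AT_G del: power_Suc)
    qed auto
    also have "\<dots> = (\<Sum>i | i \<in> ?I \<and> i \<le> d. to_fract (carlitz_Pi n) * ?L ^ Suc n
            * (psi_coeff d i * power_sum d (Suc (?m i))))"
      by (rule sum.inter_filter[OF finite_card_power_le, symmetric])
    also have "{i. i \<in> ?I \<and> i \<le> d} = {i. i \<le> d \<and> CARD('a) ^ i \<le> n}"
      by auto
    also have "(\<Sum>i\<in>\<dots>. to_fract (carlitz_Pi n) * ?L ^ Suc n * (psi_coeff d i * power_sum d (Suc (?m i))))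
        = to_fract (carlitz_Pi n) * ?L ^ Suc n * power_sum d (Suc n)"
      using False by (simp only: power_sum_Suc[of n d] sum_distrib_left neq0_conv)
    finally show ?thesis .
  qed
qed

section \<open>Residues modulo monic irreducible polynomials\<close>

lemma monic_primes_imp_prime_elem:
  "P \<in> monic_primes \<Longrightarrow> prime_elem (P :: 'a::{finite,field} poly)"
  by (auto simp: monic_primes_def intro: field_poly_irreducible_imp_prime)

lemma degree_monic_primes_pos: "P \<in> monic_primes \<Longrightarrow> degree P > 0"
  by (auto simp: monic_primes_def irreducible_def is_unit_iff_degree)

lemma monic_dvd_antisym:
  fixes f g :: "'a::field poly"
  assumes "f dvd g" "g dvd f" "lead_coeff f = 1" "lead_coeff g = 1"
  shows "f = g"
proof -
  obtain c where c: "g = f * c"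
    using assms(1) by (elim dvdE)
  have ne: "f \<noteq> 0" "g \<noteq> 0"
    using assms(3,4) by auto
  then have "degree f + degree c \<le> degree f"
    using dvd_imp_degree_le[OF assms(2)] c by (auto simp: degree_mult_eq)
  then obtain a where "c = [:a:]"
    by (auto elim: degree_eq_zeroE)
  moreover have "lead_coeff c = 1"
    using c assms(3,4) by (simp add: lead_coeff_mult)
  ultimately show ?thesis
    using c by simp
qed

text \<open>Adding \<open>monom 1 n\<close> maps these polynomials into the finite set
  \<open>monics n\<close>.\<close>

lemma finite_degree_less: "finite {a :: 'a::{finite,field} poly. degree a < n}"
proof -
  have "{a :: 'a poly. degree a < n} \<subseteq> (\<lambda>a. a - monom 1 n) ` monics n"
  proof
    fix a :: "'a poly" assume "a \<in> {a. degree a < n}"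
    then have "degree (a + monom 1 n) = n" "coeff (a + monom 1 n) n = 1"
      by (auto simp: degree_add_eq_right degree_monom_eq coeff_eq_0)
    then show "a \<in> (\<lambda>a. a - monom 1 n) ` monics n"
      by (intro image_eqI[of _ _ "a + monom 1 n"]) (auto simp: monics_def)
  qed
  then show ?thesis
    by (rule finite_subset) simp
qed

lemma finite_monic_primes_dvd:
  assumes "f \<noteq> (0 :: 'a::{finite,field} poly)"
  shows "finite {P \<in> monic_primes. P dvd f}"
  by (rule finite_subset[OF _ finite_degree_less[of "Suc (degree f)"]])
     (use assms in \<open>auto simp: less_Suc_eq_le dvd_imp_degree_le\<close>)

text \<open>An inverse modulo \<open>P\<close> chosen as a polynomial, so that denominators can be
  handled by congruences; it is meaningful only where an inverse exists.\<close>

definition pinv :: "'a::{finite,field} poly \<Rightarrow> 'a poly \<Rightarrow> 'a poly" where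
  "pinv P a = (SOME b. [a * b = 1] (mod P))"

text \<open>Multiplication by \<open>a\<close> is injective, hence surjective, on the finite set of residues.\<close>
lemma cong_mult_pinv:
  assumes P: "P \<in> monic_primes" and a: "\<not> P dvd a"
  shows "[a * pinv P a = 1] (mod P)"
proof -
  let ?R = "{b. degree b < degree P}" and ?f = "\<lambda>b. a * b mod P"
  have deg: "degree P > 0"
    using P by (rule degree_monic_primes_pos)
  have mod_R: "b mod P \<in> ?R" for b
    using degree_mod_less[of P b] deg by fastforce
  have "inj_on ?f ?R"
  proof
    fix b c assume "b \<in> ?R" "c \<in> ?R" "a * b mod P = a * c mod P"
    then have "P dvd a * (b - c)"
      by (simp add: mod_eq_dvd_iff right_diff_distrib)
    then have "P dvd b - c"
      using a monic_primes_imp_prime_elem[OF P] by (simp add: prime_elem_dvd_mult_iff)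
    moreover have "degree (b - c) < degree P"
      using \<open>b \<in> ?R\<close> \<open>c \<in> ?R\<close> by (auto intro: degree_diff_less)
    ultimately show "b = c"
      by (metis dvd_imp_degree_le eq_iff_diff_eq_0 not_less)
  qed
  then have "?f ` ?R = ?R"
    using mod_R by (intro endo_inj_surj finite_degree_less) auto
  then obtain b where "a * b mod P = 1"
    using deg by (metis (mono_tags, lifting) degree_1 imageE mem_Collect_eq)
  then have "[a * b = 1] (mod P)"
    using deg by (simp add: cong_def mod_poly_less)
  then show ?thesis
    unfolding pinv_def by (rule someI)
qed

lemma cong_mult_lcancel_monic_prime:
  assumes "P \<in> monic_primes" "\<not> P dvd c" "[c * x = c * y] (mod P)"
  shows "[x = y] (mod P)"
  using assms prime_elem_dvd_mult_iff[OF monic_primes_imp_prime_elem[OF assms(1)], of c "x - y"]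
  by (simp add: cong_iff_dvd_diff right_diff_distrib)

lemma not_dvd_prod_power:
  assumes "P \<in> monic_primes" "finite A" "\<And>i. i \<in> A \<Longrightarrow> \<not> P dvd f i"
  shows "\<not> P dvd (\<Prod>i\<in>A. f i ^ (n i))"
  using assms(2,3)
proof (induction A rule: finite_induct)
  case empty
  then show ?case
    using assms(1) by (auto simp: monic_primes_def irreducible_not_unit)
next
  case (insert i A)
  then show ?case
    using monic_primes_imp_prime_elem[OF assms(1)]
    by (auto simp: prime_elem_dvd_mult_iff dest: prime_elem_dvd_power)
qed

text \<open>After multiplication by the product of the \<open>f i ^ n i\<close> both sides become
  \<open>1\<close>.\<close>

lemma pinv_prod_power:
  assumes P: "P \<in> monic_primes" and A: "finite A" and f: "\<And>i. i \<in> A \<Longrightarrow> \<not> P dvd f i"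
  shows "[pinv P (\<Prod>i\<in>A. f i ^ n i) = (\<Prod>i\<in>A. pinv P (f i) ^ n i)] (mod P)"
proof (rule cong_mult_lcancel_monic_prime[OF P not_dvd_prod_power[OF P A f]])
  have "[(\<Prod>i\<in>A. (f i * pinv P (f i)) ^ n i) = (\<Prod>i\<in>A. 1 ^ n i)] (mod P)"
    by (intro cong_prod cong_pow cong_mult_pinv P f)
  moreover have "[(\<Prod>i\<in>A. f i ^ n i) * pinv P (\<Prod>i\<in>A. f i ^ n i) = 1] (mod P)"
    by (intro cong_mult_pinv P not_dvd_prod_power A f)
  ultimately show "[(\<Prod>i\<in>A. f i ^ n i) * pinv P (\<Prod>i\<in>A. f i ^ n i)
      = (\<Prod>i\<in>A. f i ^ n i) * (\<Prod>i\<in>A. pinv P (f i) ^ n i)] (mod P)"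
    by (simp add: power_mult_distrib prod.distrib cong_def)
qed

section \<open>Carlitz factorials and power sums modulo a prime of larger degree\<close>

lemma monics_not_dvd:
  assumes "a \<in> monics d" "d < degree P"
  shows "\<not> P dvd a"
  using assms by (auto simp: monics_def dest: dvd_imp_degree_le)

lemma carlitz_D_not_dvd:
  assumes "P \<in> monic_primes" "d < degree P"
  shows "\<not> P dvd (carlitz_D d :: 'a::{finite,field} poly)"
  unfolding carlitz_D_eq_prod_monics using not_dvd_prod_power[of P "monics d" "\<lambda>a. a" "\<lambda>_. 1"]
  by (simp add: assms monics_not_dvd[OF _ assms(2)])

lemma bracket_dvd_carlitz_D: "n > 0 \<Longrightarrow> bracket n dvd (carlitz_D n :: 'a::{finite,field} poly)"
  by (cases n) (auto simp: carlitz_D_Suc)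

text \<open>Each bracket in \<open>L\<^sub>d\<close> divides some \<open>D\<^sub>n\<close> with
  \<open>n \<le> d\<close>, and \<open>P\<close> divides none of these.\<close>

lemma carlitz_L_not_dvd:
  assumes "P \<in> monic_primes" "d < degree P"
  shows "\<not> P dvd (carlitz_L d :: 'a::{finite,field} poly)"
  using assms(2)
proof (induction d)
  case 0
  then show ?case
    by (auto dest: dvd_imp_degree_le)
next
  case (Suc d)
  have "\<not> P dvd bracket (Suc d)"
    using carlitz_D_not_dvd[OF assms(1) Suc.prems] bracket_dvd_carlitz_D[of "Suc d"]
    by (auto dest: dvd_trans)
  with Suc show ?case
    using monic_primes_imp_prime_elem[OF assms(1)]
    by (simp add: carlitz_L_Suc prime_elem_dvd_mult_iff)
qed

text \<open>Reduces \<open>twist_eval_AT_H\<close> modulo \<open>P\<close>. The factor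
  \<open>D\<^sub>d ^ s\<close> clears all denominators and, being invertible modulo
  \<open>P\<close>, is cancelled afterwards.\<close>

lemma cong_power_sum_pinv:
  assumes P: "P \<in> monic_primes" and d: "d < degree P" and s: "s \<ge> 1"
  shows "[carlitz_Gamma s * carlitz_L d ^ s * (\<Sum>a\<in>monics d. pinv P a ^ s)
     = twist_eval d (AT_H (s - 1))] (mod (P :: 'a::{finite,field} poly))"
proof -
  let ?D = "carlitz_D d :: 'a poly" and ?c = "carlitz_Gamma s * carlitz_L d ^ s :: 'a poly"
  have dvd: "a dvd ?D" if "a \<in> monics d" for a
    unfolding carlitz_D_eq_prod_monics using that by (intro dvd_prodI) auto
  have "to_fract ?D ^ s * power_sum d s = (\<Sum>a\<in>monics d. to_fract (?D div a) ^ s)"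
    unfolding power_sum_def sum_distrib_left
  proof (rule sum.cong)
    fix a :: "'a poly" assume a: "a \<in> monics d"
    have "to_fract ?D = to_fract a * to_fract (?D div a)"
      using dvd[OF a] by (simp flip: to_fract_mult)
    then show "to_fract ?D ^ s * (1 / to_fract a ^ s) = to_fract (?D div a) ^ s"
      using monics_neq_0[OF a] by (simp add: power_mult_distrib)
  qed auto
  then have "to_fract (?D ^ s * twist_eval d (AT_H (s - 1)))
      = to_fract (?c * (\<Sum>a\<in>monics d. (?D div a) ^ s))"
    using s twist_eval_AT_H[of d "s - 1", where 'a='a]
    by (simp add: to_fract_power carlitz_Gamma_def mult_ac flip: power_Suc)
  then have eq: "?D ^ s * twist_eval d (AT_H (s - 1)) = ?c * (\<Sum>a\<in>monics d. (?D div a) ^ s)"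
    by (simp only: to_fract_eq_iff)
  \<comment> \<open>Modulo \<open>P\<close>, the exact quotient by \<open>a\<close> is
    multiplication by the chosen inverse of \<open>a\<close>.\<close>
  have "[?D div a = ?D * pinv P a] (mod P)" if a: "a \<in> monics d" for a
  proof -
    have "[(?D div a) * (a * pinv P a) = (?D div a) * 1] (mod P)"
      by (intro cong_mult cong_refl cong_mult_pinv P monics_not_dvd[OF a d])
    then show ?thesis
      using dvd[OF a] by (simp add: cong_sym mult.assoc[symmetric])
  qed
  then have "[?c * (\<Sum>a\<in>monics d. (?D div a) ^ s) = ?c * (\<Sum>a\<in>monics d. (?D * pinv P a) ^ s)] (mod P)"
    by (intro cong_mult cong_refl cong_sum cong_pow)
  then have "[?D ^ s * twist_eval d (AT_H (s - 1)) = ?D ^ s * (?c * (\<Sum>a\<in>monics d. pinv P a ^ s))] (mod P)"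
    unfolding eq by (simp add: power_mult_distrib mult_ac flip: sum_distrib_left)
  moreover have "\<not> P dvd ?D ^ s"
    using not_dvd_prod_power[of P "{()}" "\<lambda>_. ?D" "\<lambda>_. s"] P carlitz_D_not_dvd[OF P d] by simp
  ultimately show ?thesis
    using cong_mult_lcancel_monic_prime[OF P] cong_sym by blast
qed

text \<open>For \<open>AT_H\<close> this exhibits the twisted coefficients
  \<open>u ^ (q ^ d)\<close> that enter the polylogarithm.\<close>

lemma twist_eval_eq_sum:
  "twist_eval d h = (\<Sum>j\<le>degree h. coeff h j ^ (CARD('a) ^ d) * (theta :: 'a::{finite,field} poly) ^ j)"
proof -
  let ?f = "\<lambda>x :: 'a poly. x ^ (CARD('a) ^ d)"
  have "map_poly ?f h = (\<Sum>j\<le>degree h. monom (?f (coeff h j)) j)"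
    by (rule poly_eqI) (auto simp: coeff_map_poly power_0_left coeff_sum coeff_eq_0)
  then show ?thesis
    by (simp add: twist_eval_def poly_sum poly_monom)
qed

section \<open>Sums over lists\<close>

text \<open>Distributivity over independent positions, transferred from functions to lists.\<close>

lemma sum_lists_prod:
  fixes f :: "nat \<Rightarrow> 'x \<Rightarrow> 'c::comm_semiring_1"
  assumes "\<And>i. i < r \<Longrightarrow> finite (B i)"
  shows "(\<Sum>xs | length xs = r \<and> (\<forall>i<r. xs ! i \<in> B i). \<Prod>i<r. f i (xs ! i))
    = (\<Prod>i<r. \<Sum>x\<in>B i. f i x)"
proof -
  have "(\<Prod>i<r. \<Sum>x\<in>B i. f i x) = (\<Sum>g\<in>(\<Pi>\<^sub>E i\<in>{..<r}. B i). \<Prod>i<r. f i (g i))"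
    using assms by (intro prod_sum_PiE) auto
  also have "\<dots> = (\<Sum>xs | length xs = r \<and> (\<forall>i<r. xs ! i \<in> B i). \<Prod>i<r. f i (xs ! i))"
    by (rule sum.reindex_bij_witness[of _ "\<lambda>xs. \<lambda>i\<in>{..<r}. xs ! i" "\<lambda>g. map g [0..<r]"])
       (auto simp: PiE_iff extensional_def fun_eq_iff intro!: nth_equalityI prod.cong)
  finally show ?thesis
    by simp
qed

text \<open>The index set of a polylogarithm component; putting \<open>N\<close> in front bounds the
  first, hence every, entry.\<close>

definition decreasing_lists :: "nat \<Rightarrow> nat \<Rightarrow> nat list set" where
  "decreasing_lists r N = {d. length d = r \<and> sorted_wrt (>) (N # d)}"

definition monic_lists :: "nat \<Rightarrow> nat \<Rightarrow> 'a::{finite,field} poly list set" where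
  "monic_lists r N = {as. length as = r \<and> (\<forall>a\<in>set as. lead_coeff a = 1) \<and>
     sorted_wrt (>) (N # map degree as)}"

lemma decreasing_lists_nth_less: "d \<in> decreasing_lists r N \<Longrightarrow> i < r \<Longrightarrow> d ! i < N"
  by (auto simp: decreasing_lists_def)

lemma finite_decreasing_lists [simp]: "finite (decreasing_lists r N)"
  by (rule finite_subset[OF _ finite_lists_length_eq[OF finite_lessThan[of N], of r]])
     (auto simp: decreasing_lists_def)

lemma finite_monic_lists [simp]: "finite (monic_lists r N)"
  by (rule finite_subset[OF _ finite_lists_length_eq[OF finite_degree_less[of N], of r]])
     (auto simp: monic_lists_def sorted_wrt_map)

lemma monic_lists_length: "as \<in> monic_lists r N \<Longrightarrow> length as = r"
  by (simp add: monic_lists_def)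

text \<open>Grouping by the tuple of degrees turns the ordering condition into a free choice of a
  monic polynomial at every position.\<close>

lemma sum_monic_lists:
  fixes f :: "'a::{finite,field} poly list \<Rightarrow> 'c::comm_monoid_add"
  shows "(\<Sum>as\<in>monic_lists r N. f as)
     = (\<Sum>d\<in>decreasing_lists r N. \<Sum>as | length as = r \<and> (\<forall>i<r. as ! i \<in> monics (d ! i)). f as)"
proof -
  have "(\<Sum>as\<in>monic_lists r N. f as)
     = (\<Sum>d\<in>decreasing_lists r N. \<Sum>as | as \<in> monic_lists r N \<and> map degree as = d. f as)"
    by (rule sum.group[symmetric, OF finite_monic_lists finite_decreasing_lists])
       (auto simp: monic_lists_def decreasing_lists_def)
  moreover have "{as \<in> monic_lists r N. map degree as = d} = {as :: 'a poly list. length as = r \<and> (\<forall>i<r. as ! i \<in> monics (d ! i))}"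
    if d: "d \<in> decreasing_lists r N" for d
  proof (rule Collect_cong)
    fix as :: "'a poly list"
    have "map degree as = d \<longleftrightarrow> (\<forall>i<r. degree (as ! i) = d ! i)" if "length as = r"
      using d that by (simp add: decreasing_lists_def list_eq_iff_nth_eq)
    moreover have "as \<in> monic_lists r N \<longleftrightarrow> length as = r \<and> (\<forall>i<r. lead_coeff (as ! i) = 1)"
      if "map degree as = d"
    proof -
      have "length as = r"
        using d that by (auto simp: decreasing_lists_def)
      with d that show ?thesis
        by (simp add: monic_lists_def decreasing_lists_def all_set_conv_all_nth del: sorted_wrt.simps)
    qed
    ultimately show "(as \<in> monic_lists r N \<and> map degree as = d)
        = (length as = r \<and> (\<forall>i<r. as ! i \<in> monics (d ! i)))"
      unfolding monics_def mem_Collect_eq using monic_lists_length[of as r N] by blast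
  qed
  ultimately show ?thesis
    by (simp cong: sum.cong)
qed

section \<open>The congruence at a prime of the larger field\<close>

locale finite_field_ext = hom: semiring_hom inc
  for inc :: "'a::{finite,field} \<Rightarrow> 'b::{finite,field}"
begin

sublocale poly_hom: semiring_hom "map_poly inc"
  by (rule hom.map_poly_hom)

lemma inc_eq_0_iff [simp]: "inc x = 0 \<longleftrightarrow> x = 0"
proof
  assume "inc x = 0"
  then have "inc (x * inverse x) = 0"
    by (simp add: hom.mult)
  then show "x = 0"
    using hom.one by (cases "x = 0") auto
qed (simp add: hom.zero)

lemma degree_map_poly_inc [simp]: "degree (map_poly inc f) = degree f"
  by (rule degree_map_poly) simp

lemma map_poly_inc_eq_0_iff [simp]: "map_poly inc f = 0 \<longleftrightarrow> f = 0"
  by (auto simp: poly_eq_iff coeff_map_poly hom.zero)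

lemma map_poly_inc_diff: "map_poly inc (f - g) = map_poly inc f - map_poly inc g"
  using poly_hom.add[of "f - g" g] by simp

lemma map_poly_inc_theta [simp]: "map_poly inc theta = theta"
  by (simp add: theta_def map_poly_pCons hom.zero hom.one)

text \<open>
  \<open>Q\<close> divides the image of some nonzero polynomial since the residues modulo \<open>Q\<close> are finitely many;
  one of minimal degree is irreducible.
\<close>
lemma exists_monic_prime_below:
  assumes Q: "Q \<in> monic_primes"
  shows "\<exists>P\<in>monic_primes. Q dvd map_poly inc P"
proof -
  have deg: "degree Q > 0"
    using Q by (rule degree_monic_primes_pos)
  have "b mod Q \<in> {b. degree b < degree Q}" for b
    using degree_mod_less[of Q b] deg by fastforce
  then have "finite (range (\<lambda>n. map_poly inc (theta ^ n) mod Q))"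
    by (intro finite_subset[OF _ finite_degree_less[of "degree Q"]]) blast
  then have "\<not> inj (\<lambda>n. map_poly inc (theta ^ n) mod Q)"
    by (meson finite_imageD infinite_UNIV_nat)
  then obtain m n where "m \<noteq> n" "map_poly inc (theta ^ m) mod Q = map_poly inc (theta ^ n) mod Q"
    by (auto simp: inj_def)
  then have "theta ^ m - theta ^ n \<noteq> 0 \<and> Q dvd map_poly inc (theta ^ m - theta ^ n)"
    by (simp add: mod_eq_dvd_iff map_poly_inc_diff)
  then obtain f where f: "f \<noteq> 0" "Q dvd map_poly inc f"
    and min: "\<And>g. g \<noteq> 0 \<Longrightarrow> Q dvd map_poly inc g \<Longrightarrow> degree f \<le> degree g"
    using ex_has_least_nat[of "\<lambda>f. f \<noteq> 0 \<and> Q dvd map_poly inc f" _ degree] by blast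
  define P where "P = smult (inverse (lead_coeff f)) f"
  have unit: "is_unit [:inverse (lead_coeff f):]"
    using f by (simp add: is_unit_pCons_iff)
  have P: "P \<noteq> 0" "lead_coeff P = 1" "degree P = degree f"
    using f by (auto simp: P_def)
  have dvdP: "Q dvd map_poly inc P"
    using f(2) poly_hom.mult[of "[:inverse (lead_coeff f):]" f] by (simp add: P_def)
  have "irreducible P"
  proof (rule irreducibleI)
    show "P \<noteq> 0" by fact
    have "degree Q \<le> degree P"
      using dvd_imp_degree_le[OF dvdP] P by simp
    with deg show "\<not> is_unit P"
      using P(1) by (simp add: is_unit_iff_degree)
    fix g h assume gh: "P = g * h"
    then have ne: "g \<noteq> 0" "h \<noteq> 0"
      using P by auto
    then have "degree P = degree g + degree h"
      by (simp add: gh degree_mult_eq)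
    moreover have "Q dvd map_poly inc g \<or> Q dvd map_poly inc h"
      using dvdP monic_primes_imp_prime_elem[OF Q] by (simp add: gh poly_hom.mult prime_elem_dvd_mult_iff)
    ultimately have "degree h = 0 \<or> degree g = 0"
      using min[of g] min[of h] ne P(3) by auto
    then show "is_unit g \<or> is_unit h"
      using ne by (auto simp: is_unit_iff_degree)
  qed
  with P dvdP show ?thesis
    by (auto simp: monic_primes_def)
qed

text \<open>If \<open>P\<close> does not divide \<open>a\<close>, then
  \<open>a * b - 1 = P * c\<close> for an inverse \<open>b\<close> of \<open>a\<close>. Applying
  \<open>map_poly inc\<close> would make \<open>Q\<close> a divisor of \<open>1\<close> once it
  divides the image of \<open>a\<close>.\<close>

lemma dvd_map_poly_inc_iff:
  assumes Q: "Q \<in> monic_primes" and P: "P \<in> monic_primes" "Q dvd map_poly inc P"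
  shows "Q dvd map_poly inc a \<longleftrightarrow> P dvd a"
proof
  assume "P dvd a"
  then show "Q dvd map_poly inc a"
    using P(2) by (auto elim!: dvdE[of P a] simp: poly_hom.mult)
next
  assume a: "Q dvd map_poly inc a"
  show "P dvd a"
  proof (rule ccontr)
    assume "\<not> P dvd a"
    then obtain c where c: "a * pinv P a - 1 = P * c"
      using cong_mult_pinv[OF P(1)] by (auto simp: cong_iff_dvd_diff)
    have "map_poly inc a * map_poly inc (pinv P a) - 1 = map_poly inc P * map_poly inc c"
      using arg_cong[OF c, of "map_poly inc"] by (simp add: map_poly_inc_diff poly_hom.mult poly_hom.one)
    then have "Q dvd 1"
      using a P(2) by (metis dvd_diff_right_iff dvd_mult2 one_dvd)
    with Q show False
      by (auto simp: monic_primes_def irreducible_not_unit)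
  qed
qed

text \<open>Two monic primes whose images are divisible by \<open>Q\<close> divide each other, so
  the description in \<open>below\<close> is unique.\<close>

lemma below_monic_primes: "Q \<in> monic_primes \<Longrightarrow> below inc Q \<in> monic_primes"
  and dvd_below: "Q \<in> monic_primes \<Longrightarrow> Q dvd map_poly inc (below inc Q)"
proof -
  assume Q: "Q \<in> monic_primes"
  have "\<exists>!P. P \<in> monic_primes \<and> Q dvd map_poly inc P"
  proof (rule ex_ex1I)
    show "\<exists>P. P \<in> monic_primes \<and> Q dvd map_poly inc P"
      using exists_monic_prime_below[OF Q] by blast
  next
    fix P P' assume *: "P \<in> monic_primes \<and> Q dvd map_poly inc P" "P' \<in> monic_primes \<and> Q dvd map_poly inc P'"
    then have "P dvd P'" "P' dvd P"
      using dvd_map_poly_inc_iff[OF Q] by blast+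
    with * show "P = P'"
      by (intro monic_dvd_antisym) (auto simp: monic_primes_def)
  qed
  from theI'[OF this] show "below inc Q \<in> monic_primes" "Q dvd map_poly inc (below inc Q)"
    by (auto simp: below_def)
qed

lemma dvd_map_poly_inc_iff_below:
  "Q \<in> monic_primes \<Longrightarrow> Q dvd map_poly inc a \<longleftrightarrow> below inc Q dvd a"
  by (intro dvd_map_poly_inc_iff below_monic_primes dvd_below)

text \<open>All these \<open>Q\<close> divide one nonzero polynomial. Hence a finite exceptional set
  of \<open>P\<close> stays finite when lifted to the larger field.\<close>

lemma finite_below_eq: "P \<in> monic_primes \<Longrightarrow> finite {Q \<in> monic_primes. below inc Q = P}"
  by (rule finite_subset[OF _ finite_monic_primes_dvd[of "map_poly inc P"]])
     (auto simp: dvd_below monic_primes_def)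

lemma cong_map_poly_inc:
  "Q \<in> monic_primes \<Longrightarrow> [a = b] (mod below inc Q) \<Longrightarrow> [map_poly inc a = map_poly inc b] (mod Q)"
  by (simp add: cong_iff_dvd_diff dvd_map_poly_inc_iff_below flip: map_poly_inc_diff)

end

section \<open>Polynomial representatives of the components and the congruence between them\<close>

definition zeta_rep :: "nat list \<Rightarrow> 'a::{finite,field} list \<Rightarrow> 'a poly \<Rightarrow> 'a poly" where
  "zeta_rep s \<epsilon> P = (\<Sum>as\<in>monic_lists (length s) (degree P).
     (\<Prod>i<length s. [:\<epsilon> ! i:] ^ degree (as ! i)) * pinv P (\<Prod>i<length s. (as ! i) ^ (s ! i)))"

definition Li_rep ::
    "('a::{finite,field} \<Rightarrow> 'b::{finite,field}) \<Rightarrow> nat list \<Rightarrow> 'b poly \<Rightarrow> (nat \<Rightarrow> 'b poly) \<Rightarrow> 'b poly" where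
  "Li_rep inc s Q x = (\<Sum>d\<in>decreasing_lists (length s) (degree (below inc Q)).
     (\<Prod>i<length s. x i ^ (CARD('a) ^ (d ! i)))
       * pinv Q (\<Prod>i<length s. map_poly inc (carlitz_L (d ! i)) ^ (s ! i)))"

text \<open>For fixed degrees the sum over tuples is a product over positions, and each factor is
  treated by \<open>cong_power_sum_pinv\<close>.\<close>

lemma cong_sum_monics_lists:
  fixes P :: "'a::{finite,field} poly"
  assumes P: "P \<in> monic_primes" and d: "\<And>i. i < length s \<Longrightarrow> d ! i < degree P"
    and s: "\<And>i. i < length s \<Longrightarrow> s ! i \<ge> 1"
  shows "[(\<Prod>i<length s. carlitz_Gamma (s ! i)) * (\<Prod>i<length s. carlitz_L (d ! i) ^ (s ! i))
      * (\<Sum>as | length as = length s \<and> (\<forall>i<length s. as ! i \<in> monics (d ! i)).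
          (\<Prod>i<length s. [:\<epsilon> ! i:] ^ degree (as ! i)) * pinv P (\<Prod>i<length s. (as ! i) ^ (s ! i)))
    = (\<Prod>i<length s. [:\<epsilon> ! i:] ^ (d ! i) * twist_eval (d ! i) (AT_H (s ! i - 1)))] (mod P)"
    (is "[?G * ?L * ?S = _] (mod P)")
proof -
  let ?r = "length s"
  let ?B = "{as :: 'a poly list. length as = ?r \<and> (\<forall>i<?r. as ! i \<in> monics (d ! i))}"
  have "[?S = (\<Sum>as\<in>?B. \<Prod>i<?r. [:\<epsilon> ! i:] ^ (d ! i) * pinv P (as ! i) ^ (s ! i))] (mod P)"
  proof (rule cong_sum)
    fix as assume as: "as \<in> ?B"
    have "[pinv P (\<Prod>i<?r. (as ! i) ^ (s ! i)) = (\<Prod>i<?r. pinv P (as ! i) ^ (s ! i))] (mod P)"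
      using as d monics_not_dvd[of _ _ P] by (intro pinv_prod_power P) blast+
    moreover have "(\<Prod>i<?r. [:\<epsilon> ! i:] ^ degree (as ! i)) = (\<Prod>i<?r. [:\<epsilon> ! i:] ^ (d ! i))"
      using as by (auto simp: monics_def intro!: prod.cong)
    ultimately show "[(\<Prod>i<?r. [:\<epsilon> ! i:] ^ degree (as ! i)) * pinv P (\<Prod>i<?r. (as ! i) ^ (s ! i))
        = (\<Prod>i<?r. [:\<epsilon> ! i:] ^ (d ! i) * pinv P (as ! i) ^ (s ! i))] (mod P)"
      by (simp add: prod.distrib cong_mult)
  qed
  also have "(\<Sum>as\<in>?B. \<Prod>i<?r. [:\<epsilon> ! i:] ^ (d ! i) * pinv P (as ! i) ^ (s ! i))
      = (\<Prod>i<?r. \<Sum>a\<in>monics (d ! i). [:\<epsilon> ! i:] ^ (d ! i) * pinv P a ^ (s ! i))"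
    by (rule sum_lists_prod) simp
  finally have "[?G * ?L * ?S
      = ?G * ?L * (\<Prod>i<?r. \<Sum>a\<in>monics (d ! i). [:\<epsilon> ! i:] ^ (d ! i) * pinv P a ^ (s ! i))] (mod P)"
    by (intro cong_mult cong_refl)
  also have "?G * ?L * (\<Prod>i<?r. \<Sum>a\<in>monics (d ! i). [:\<epsilon> ! i:] ^ (d ! i) * pinv P a ^ (s ! i))
      = (\<Prod>i<?r. [:\<epsilon> ! i:] ^ (d ! i) * (carlitz_Gamma (s ! i) * carlitz_L (d ! i) ^ (s ! i)
          * (\<Sum>a\<in>monics (d ! i). pinv P a ^ (s ! i))))"
    unfolding sum_distrib_left[symmetric] prod.distrib by (simp only: mult_ac)
  also have "[\<dots> = (\<Prod>i<?r. [:\<epsilon> ! i:] ^ (d ! i) * twist_eval (d ! i) (AT_H (s ! i - 1)))] (mod P)"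
    using d s by (intro cong_prod cong_mult cong_refl cong_power_sum_pinv P) auto
  finally show ?thesis .
qed

text \<open>Induction from \<open>g ^ q = g * inc e\<close> and \<open>e ^ q = e\<close>; this turns
  the twists of the \<open>\<gamma>\<^sub>i\<close> into the alternating factors
  \<open>\<epsilon>\<^sub>i ^ d\<close>.\<close>

lemma (in finite_field_ext) power_card_power_eq:
  fixes g :: "'b poly"
  assumes "g ^ (CARD('a) - 1) = [:inc e:]"
  shows "g ^ (CARD('a) ^ d) = g * map_poly inc ([:e:] ^ d)"
proof (induction d)
  case (Suc d)
  have q: "g ^ CARD('a) = g * [:inc e:]"
    using power_Suc[of g "CARD('a) - 1"] card_field_ge_2[where 'a='a] assms by simp
  have "g ^ (CARD('a) ^ Suc d) = (g * map_poly inc ([:e:] ^ d)) ^ CARD('a)"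
    unfolding Suc[symmetric] by (simp add: mult.commute flip: power_mult)
  also have "\<dots> = g * [:inc e:] * map_poly inc (([:e:] ^ CARD('a)) ^ d)"
    by (simp add: power_mult_distrib q poly_hom.power flip: power_mult) (simp add: mult.commute)
  also have "[:e:] ^ CARD('a) = [:e:]"
    by (simp add: poly_const_pow finite_field_power_card)
  also have "g * [:inc e:] * map_poly inc ([:e:] ^ d) = g * map_poly inc ([:e:] ^ Suc d)"
    by (simp add: poly_hom.mult map_poly_pCons hom.zero del: mult_pCons_left mult_pCons_right)
  finally show ?case .
qed (simp add: poly_hom.one)

text \<open>With the Carlitz gamma factors kept on the zeta side the congruence holds at every
  \<open>Q\<close>, including those that divide them. It is proved for each degree tuple
  \<open>d\<close> and then summed.\<close>

lemma (in finite_field_ext) cong_zeta_rep: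
  fixes \<gamma> :: "nat \<Rightarrow> 'b poly"
  assumes Q: "Q \<in> monic_primes"
    and s: "\<And>i. i < length s \<Longrightarrow> s ! i \<ge> 1"
    and \<gamma>: "\<And>i. i < length s \<Longrightarrow> \<gamma> i ^ (CARD('a) - 1) = [:inc (\<epsilon> ! i):]"
  shows "[(\<Prod>i<length s. \<gamma> i * map_poly inc (carlitz_Gamma (s ! i)))
        * map_poly inc (zeta_rep s \<epsilon> (below inc Q))
      = (\<Sum>j\<in>AT_J TYPE('a) s. theta ^ sum_list j
          * Li_rep inc s Q (\<lambda>i. \<gamma> i * map_poly inc (AT_u (s ! i) (j ! i))))] (mod Q)"
proof -
  let ?r = "length s" and ?P = "below inc Q" and ?q = "CARD('a)" and ?I = "map_poly inc"
  let ?D = "decreasing_lists ?r (degree ?P)"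
  let ?u = "\<lambda>i j. AT_u (s ! i) j :: 'a poly"
  let ?H = "\<lambda>i. AT_H (s ! i - 1) :: 'a poly poly"
  let ?S = "\<lambda>d. \<Sum>as | length as = ?r \<and> (\<forall>i<?r. as ! i \<in> monics (d ! i)).
          (\<Prod>i<?r. [:\<epsilon> ! i:] ^ degree (as ! i)) * pinv ?P (\<Prod>i<?r. (as ! i) ^ (s ! i))"
  let ?L = "\<lambda>d. \<Prod>i<?r. carlitz_L (d ! i) ^ (s ! i) :: 'a poly"
  let ?G = "\<Prod>i<?r. carlitz_Gamma (s ! i) :: 'a poly"
  have P: "?P \<in> monic_primes"
    using Q by (rule below_monic_primes)
  \<comment> \<open>For fixed \<open>d\<close> the sum over \<open>j\<close> factors by position
    into the specialised Anderson--Thakur polynomials.\<close>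
  have Li: "(\<Sum>j\<in>AT_J TYPE('a) s. theta ^ sum_list j * (\<Prod>i<?r. (\<gamma> i * ?I (?u i (j ! i))) ^ (?q ^ (d ! i))))
      = (\<Prod>i<?r. \<gamma> i * ?I ([:\<epsilon> ! i:] ^ (d ! i) * twist_eval (d ! i) (?H i)))" for d
  proof -
    have "(\<Sum>j\<in>AT_J TYPE('a) s. theta ^ sum_list j * (\<Prod>i<?r. (\<gamma> i * ?I (?u i (j ! i))) ^ (?q ^ (d ! i))))
        = (\<Sum>j | length j = ?r \<and> (\<forall>i<?r. j ! i \<in> {..degree (?H i)}).
            \<Prod>i<?r. theta ^ (j ! i) * (\<gamma> i * ?I (?u i (j ! i))) ^ (?q ^ (d ! i)))"
      by (intro sum.cong) (auto simp: AT_J_def prod.distrib sum_list_sum_nth atLeast0LessThan power_sum)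
    also have "\<dots> = (\<Prod>i<?r. \<Sum>j\<le>degree (?H i). theta ^ j * (\<gamma> i * ?I (?u i j)) ^ (?q ^ (d ! i)))"
      by (rule sum_lists_prod) simp
    also have "\<dots> = (\<Prod>i<?r. \<gamma> i ^ (?q ^ (d ! i)) * ?I (twist_eval (d ! i) (?H i)))"
      by (simp add: twist_eval_eq_sum poly_hom.sum poly_hom.mult poly_hom.power sum_distrib_left
          power_mult_distrib AT_u_def mult_ac)
    also have "\<dots> = (\<Prod>i<?r. \<gamma> i * ?I ([:\<epsilon> ! i:] ^ (d ! i) * twist_eval (d ! i) (?H i)))"
      using \<gamma> by (intro prod.cong) (auto simp: power_card_power_eq poly_hom.mult mult.assoc)
    finally show ?thesis .
  qed
  have "[(\<Prod>i<?r. \<gamma> i) * ?I ?G * ?I (?S d)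
      = (\<Prod>i<?r. \<gamma> i * ?I ([:\<epsilon> ! i:] ^ (d ! i) * twist_eval (d ! i) (?H i)))
        * pinv Q (\<Prod>i<?r. ?I (carlitz_L (d ! i)) ^ (s ! i))] (mod Q)" if d: "d \<in> ?D" for d
  proof -
    have IL: "?I (?L d) = (\<Prod>i<?r. ?I (carlitz_L (d ! i)) ^ (s ! i))"
      by (simp add: poly_hom.prod poly_hom.power)
    have less: "d ! i < degree ?P" if "i < ?r" for i
      using d that by (rule decreasing_lists_nth_less)
    have "\<not> ?P dvd ?L d"
      using less carlitz_L_not_dvd[OF P] by (intro not_dvd_prod_power P) auto
    \<comment> \<open>Inserting this factor \<open>1\<close> supplies the power of \<open>L\<close>
      that \<open>cong_sum_monics_lists\<close> has on its left side.\<close>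
    then have "[?I (?L d) * pinv Q (?I (?L d)) = 1] (mod Q)"
      by (intro cong_mult_pinv Q) (simp add: dvd_map_poly_inc_iff_below Q)
    then have "[(\<Prod>i<?r. \<gamma> i) * ?I ?G * ?I (?S d) * (?I (?L d) * pinv Q (?I (?L d)))
        = (\<Prod>i<?r. \<gamma> i) * ?I ?G * ?I (?S d) * 1] (mod Q)"
      by (intro cong_mult cong_refl)
    moreover have "[?I (?G * ?L d * ?S d)
        = ?I (\<Prod>i<?r. [:\<epsilon> ! i:] ^ (d ! i) * twist_eval (d ! i) (?H i))] (mod Q)"
      using less s by (intro cong_map_poly_inc Q cong_sum_monics_lists P)
    then have "[(\<Prod>i<?r. \<gamma> i) * pinv Q (?I (?L d)) * ?I (?G * ?L d * ?S d)
       = (\<Prod>i<?r. \<gamma> i) * pinv Q (?I (?L d))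
         * ?I (\<Prod>i<?r. [:\<epsilon> ! i:] ^ (d ! i) * twist_eval (d ! i) (?H i))] (mod Q)"
      by (intro cong_mult cong_refl)
    ultimately show ?thesis
      unfolding IL[symmetric]
      by (simp add: poly_hom.mult poly_hom.prod prod.distrib mult_ac cong_def)
  qed
  then have "[(\<Sum>d\<in>?D. (\<Prod>i<?r. \<gamma> i) * ?I ?G * ?I (?S d))
     = (\<Sum>d\<in>?D. (\<Prod>i<?r. \<gamma> i * ?I ([:\<epsilon> ! i:] ^ (d ! i) * twist_eval (d ! i) (?H i)))
        * pinv Q (\<Prod>i<?r. ?I (carlitz_L (d ! i)) ^ (s ! i)))] (mod Q)"
    by (rule cong_sum)
  also have "(\<Sum>d\<in>?D. (\<Prod>i<?r. \<gamma> i) * ?I ?G * ?I (?S d))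
     = (\<Prod>i<?r. \<gamma> i * ?I (carlitz_Gamma (s ! i))) * ?I (zeta_rep s \<epsilon> ?P)"
    by (simp add: zeta_rep_def sum_monic_lists poly_hom.sum[of _ ?D] poly_hom.prod prod.distrib sum_distrib_left[of _ _ ?D])
  also have "(\<Sum>d\<in>?D. (\<Prod>i<?r. \<gamma> i * ?I ([:\<epsilon> ! i:] ^ (d ! i) * twist_eval (d ! i) (?H i)))
        * pinv Q (\<Prod>i<?r. ?I (carlitz_L (d ! i)) ^ (s ! i)))
     = (\<Sum>d\<in>?D. \<Sum>j\<in>AT_J TYPE('a) s. theta ^ sum_list j * ((\<Prod>i<?r. (\<gamma> i * ?I (?u i (j ! i))) ^ (?q ^ (d ! i)))
        * pinv Q (\<Prod>i<?r. ?I (carlitz_L (d ! i)) ^ (s ! i))))"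
    unfolding Li[symmetric] sum_distrib_right mult.assoc by (rule refl)
  also have "\<dots> = (\<Sum>j\<in>AT_J TYPE('a) s. theta ^ sum_list j
          * Li_rep inc s Q (\<lambda>i. \<gamma> i * map_poly inc (AT_u (s ! i) (j ! i))))"
    by (subst sum.swap) (simp add: Li_rep_def sum_distrib_left)
  finally show ?thesis .
qed

section \<open>Residue rings and the rings \<open>\<A>\<^sub>k\<close>\<close>

lemma poly_ring_simps [simp]:
  "carrier poly_ring = UNIV" "x \<otimes>\<^bsub>poly_ring\<^esub> y = x * y" "\<one>\<^bsub>poly_ring\<^esub> = 1"
  "x \<oplus>\<^bsub>poly_ring\<^esub> y = x + y" "\<zero>\<^bsub>poly_ring\<^esub> = 0"
  by (simp_all add: ring_of_type_algebra_def)

lemma resid_ring_hom_cring: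
  "ring_hom_cring poly_ring (resid_ring P) (resid (P :: 'a::{finite,field} poly))"
proof -
  have R: "cring (poly_ring :: 'a poly ring)"
    by (rule cring_from_type_algebra)
  then have "ideal (PIdl\<^bsub>poly_ring\<^esub> P) poly_ring"
    by (rule cring.cgenideal_ideal) simp
  from ideal.rcos_ring_hom_cring[OF this R] show ?thesis
    by (simp add: resid_ring_def resid_def[abs_def])
qed

lemmas resid_ring_hom = ring_hom_cring.homh[OF resid_ring_hom_cring]

interpretation resid_ring: cring "resid_ring P" for P :: "'a::{finite,field} poly"
  using resid_ring_hom_cring[of P] by (rule ring_hom_cring.axioms(2))

text \<open>Cosets of the principal ideal are congruence classes, so equations in
  \<open>resid_ring P\<close> become congruences of polynomials.\<close>

lemma mem_resid_iff: "x \<in> resid P a \<longleftrightarrow> [x = a] (mod P)"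
proof -
  have "x \<in> resid P a \<longleftrightarrow> (\<exists>c. x = c * P + a)"
    by (auto simp: resid_def a_r_coset_def' cgenideal_def)
  also have "\<dots> \<longleftrightarrow> P dvd x - a"
    by (auto simp: dvd_def algebra_simps)
  finally show ?thesis
    by (simp add: cong_iff_dvd_diff)
qed

lemma resid_eq_iff: "resid P a = resid P b \<longleftrightarrow> [a = b] (mod P)"
proof -
  have "resid P a = resid P b \<longleftrightarrow> (\<forall>x. [x = a] (mod P) \<longleftrightarrow> [x = b] (mod P))"
    by (simp add: set_eq_iff mem_resid_iff)
  also have "\<dots> \<longleftrightarrow> [a = b] (mod P)"
    by (metis cong_refl cong_sym cong_trans)
  finally show ?thesis .
qed

lemma carrier_resid_ring: "carrier (resid_ring P) = range (resid P)"
  by (auto simp: resid_ring_def resid_def[abs_def] FactRing_def A_RCOSETS_def')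

lemma resid_closed [simp]: "resid P a \<in> carrier (resid_ring P)"
  by (simp add: carrier_resid_ring)

lemma resid_add: "resid P a \<oplus>\<^bsub>resid_ring P\<^esub> resid P b = resid P (a + b)"
  using ring_hom_add[OF resid_ring_hom, of a b P] by simp

lemma resid_mult: "resid P a \<otimes>\<^bsub>resid_ring P\<^esub> resid P b = resid P (a * b)"
  using ring_hom_mult[OF resid_ring_hom, of a b P] by simp

lemma resid_zero: "\<zero>\<^bsub>resid_ring P\<^esub> = resid P 0"
  using ring_hom_cring.hom_zero[OF resid_ring_hom_cring[of P]] by simp

lemma resid_one: "\<one>\<^bsub>resid_ring P\<^esub> = resid P 1"
  using ring_hom_one[OF resid_ring_hom, of P] by simp

lemma resid_power: "resid P a [^]\<^bsub>resid_ring P\<^esub> n = resid P (a ^ n)"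
  for n :: nat
  by (induction n) (simp_all add: resid_one resid_mult mult.commute)

lemma resid_finsum:
  "(\<Oplus>\<^bsub>resid_ring P\<^esub>x\<in>A. resid P (f x)) = resid P (\<Sum>x\<in>A. f x)"
proof (induction A rule: infinite_finite_induct)
  case (insert x A)
  then show ?case
    by (subst resid_ring.finsum_insert) (auto simp: resid_add)
qed (auto simp: resid_ring.finsum_infinite resid_zero)

lemma resid_finprod:
  "(\<Otimes>\<^bsub>resid_ring P\<^esub>x\<in>A. resid P (f x)) = resid P (\<Prod>x\<in>A. f x)"
proof (induction A rule: infinite_finite_induct)
  case (insert x A)
  then show ?case
    by (subst resid_ring.finprod_insert) (auto simp: resid_mult)
qed (auto simp: resid_ring.finprod_infinite resid_one)

lemma resid_inv:
  assumes "P \<in> monic_primes" "\<not> P dvd a"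
  shows "inv\<^bsub>resid_ring P\<^esub> resid P a = resid P (pinv P a)"
  using assms
  by (intro resid_ring.comm_inv_char)
     (simp_all add: resid_mult resid_one resid_eq_iff cong_mult_pinv)

section \<open>Products of rings, direct sums and their quotient\<close>

lemma prod_ring_simps:
  "carrier (prod_ring I R) = (\<Pi>\<^sub>E i\<in>I. carrier (R i))"
  "f \<otimes>\<^bsub>prod_ring I R\<^esub> g = (\<lambda>i\<in>I. f i \<otimes>\<^bsub>R i\<^esub> g i)"
  "\<one>\<^bsub>prod_ring I R\<^esub> = (\<lambda>i\<in>I. \<one>\<^bsub>R i\<^esub>)"
  "f \<oplus>\<^bsub>prod_ring I R\<^esub> g = (\<lambda>i\<in>I. f i \<oplus>\<^bsub>R i\<^esub> g i)"
  "\<zero>\<^bsub>prod_ring I R\<^esub> = (\<lambda>i\<in>I. \<zero>\<^bsub>R i\<^esub>)"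
  by (simp_all add: prod_ring_def)

lemma cring_prod_ring:
  assumes R: "\<And>i. i \<in> I \<Longrightarrow> cring (R i)"
  shows "cring (prod_ring I R)"
proof (rule cringI)
  note ring_rules = cring.axioms(1)[OF R]
  show "abelian_group (prod_ring I R)"
  proof (rule abelian_groupI)
    fix f assume f: "f \<in> carrier (prod_ring I R)"
    show "\<exists>g\<in>carrier (prod_ring I R). g \<oplus>\<^bsub>prod_ring I R\<^esub> f = \<zero>\<^bsub>prod_ring I R\<^esub>"
    proof (rule bexI[of _ "\<lambda>i\<in>I. \<ominus>\<^bsub>R i\<^esub> f i"])
      show "(\<lambda>i\<in>I. \<ominus>\<^bsub>R i\<^esub> f i) \<oplus>\<^bsub>prod_ring I R\<^esub> f = \<zero>\<^bsub>prod_ring I R\<^esub>"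
        using f ring_rules by (auto simp: prod_ring_simps PiE_iff abelian_group.l_neg ring.is_abelian_group intro!: restrict_ext)
    qed (use f ring_rules in \<open>auto simp: prod_ring_simps PiE_iff intro!: abelian_group.a_inv_closed ring.is_abelian_group\<close>)
  qed (use ring_rules in \<open>auto simp: prod_ring_simps PiE_iff fun_eq_iff extensional_def
        ring.ring_simprules abelian_monoid.a_closed\<close>)
  show "comm_monoid (prod_ring I R)"
    by (rule comm_monoidI)
       (use R in \<open>auto simp: prod_ring_simps PiE_iff fun_eq_iff extensional_def cring.cring_simprules
         monoid.r_one ring.is_monoid ring_rules\<close>)
  fix f g h
  assume "f \<in> carrier (prod_ring I R)" "g \<in> carrier (prod_ring I R)" "h \<in> carrier (prod_ring I R)"
  then show "(f \<oplus>\<^bsub>prod_ring I R\<^esub> g) \<otimes>\<^bsub>prod_ring I R\<^esub> h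
      = f \<otimes>\<^bsub>prod_ring I R\<^esub> h \<oplus>\<^bsub>prod_ring I R\<^esub> g \<otimes>\<^bsub>prod_ring I R\<^esub> h"
    using R by (auto simp: prod_ring_simps PiE_iff cring.cring_simprules(13) intro!: restrict_ext)
qed

text \<open>Multiplication does not enlarge supports, and the support of a sum lies in the union of
  the supports.\<close>

lemma ideal_direct_sum:
  assumes R: "\<And>i. i \<in> I \<Longrightarrow> cring (R i)"
  shows "ideal (direct_sum I R) (prod_ring I R)"
proof -
  interpret cring "prod_ring I R"
    using R by (rule cring_prod_ring)
  have closed: "f i \<in> carrier (R i)" if "f \<in> carrier (prod_ring I R)" "i \<in> I" for f i
    using that by (auto simp: prod_ring_simps)
  note ring_R = cring.axioms(1)[OF R]
  let ?supp = "\<lambda>f. {i \<in> I. f i \<noteq> \<zero>\<^bsub>R i\<^esub>}"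
  have mult: "h \<otimes>\<^bsub>prod_ring I R\<^esub> f \<in> direct_sum I R"
    if f: "f \<in> direct_sum I R" and h: "h \<in> carrier (prod_ring I R)" for f h
  proof -
    have "?supp (h \<otimes>\<^bsub>prod_ring I R\<^esub> f) \<subseteq> ?supp f"
      using h closed ring_R by (auto simp: prod_ring_simps(2) ring.ring_simprules)
    then show ?thesis
      using f h m_closed by (auto simp: direct_sum_def dest: finite_subset)
  qed
  show ?thesis
  proof (rule idealI)
    show "subgroup (direct_sum I R) (add_monoid (prod_ring I R))"
    proof (rule add.subgroupI)
      show "direct_sum I R \<noteq> {}"
        using zero_closed by (auto simp: direct_sum_def prod_ring_simps(5))
      show "\<ominus>\<^bsub>prod_ring I R\<^esub> f \<in> direct_sum I R" if f: "f \<in> direct_sum I R" for f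
      proof -
        have "f \<in> carrier (prod_ring I R)"
          using f by (simp add: direct_sum_def)
        \<comment> \<open>Negation is multiplication by minus one, so closure follows from
          \<open>mult\<close>.\<close>
        then have "\<ominus>\<^bsub>prod_ring I R\<^esub> f = (\<ominus>\<^bsub>prod_ring I R\<^esub> \<one>\<^bsub>prod_ring I R\<^esub>) \<otimes>\<^bsub>prod_ring I R\<^esub> f"
          by (simp add: l_minus)
        with mult[OF f] show ?thesis
          by simp
      qed
      fix f g assume fg: "f \<in> direct_sum I R" "g \<in> direct_sum I R"
      then have c: "f \<in> carrier (prod_ring I R)" "g \<in> carrier (prod_ring I R)"
        by (auto simp: direct_sum_def)
      have "?supp (f \<oplus>\<^bsub>prod_ring I R\<^esub> g) \<subseteq> ?supp f \<union> ?supp g"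
        using ring_R by (auto simp: prod_ring_simps(4) ring.ring_simprules)
      then show "f \<oplus>\<^bsub>prod_ring I R\<^esub> g \<in> direct_sum I R"
        using fg c a_closed by (auto simp: direct_sum_def dest: finite_subset)
    qed (auto simp: direct_sum_def)
    fix f h assume fh: "f \<in> direct_sum I R" "h \<in> carrier (prod_ring I R)"
    then show "h \<otimes>\<^bsub>prod_ring I R\<^esub> f \<in> direct_sum I R"
      by (rule mult)
    with fh show "f \<otimes>\<^bsub>prod_ring I R\<^esub> h \<in> direct_sum I R"
      by (simp add: direct_sum_def m_comm)
  qed (rule ring_axioms)
qed

lemma cring_resid_prod: "cring (resid_prod :: 'a::{finite,field} family ring)"
  unfolding resid_prod_def by (intro cring_prod_ring resid_ring.is_cring)

lemma ideal_resid_sum: "ideal resid_sum (resid_prod :: 'a::{finite,field} family ring)"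
  unfolding resid_prod_def resid_sum_def by (intro ideal_direct_sum resid_ring.is_cring)

lemma fin_class_ring_hom_cring:
  "ring_hom_cring (resid_prod :: 'a::{finite,field} family ring) fin_ring fin_class"
  using ideal.rcos_ring_hom_cring[OF ideal_resid_sum cring_resid_prod]
  by (simp add: fin_ring_def fin_class_def[abs_def])

lemmas fin_class_ring_hom = ring_hom_cring.homh[OF fin_class_ring_hom_cring]

interpretation fin_ring: cring "fin_ring :: 'a::{finite,field} family set ring"
  using fin_class_ring_hom_cring by (rule ring_hom_cring.axioms(2))

section \<open>Classes of families of polynomials\<close>

definition fam :: "('a::{finite,field} poly \<Rightarrow> 'a poly) \<Rightarrow> 'a family" where
  "fam F = (\<lambda>P\<in>monic_primes. resid P (F P))"

text \<open>Choosing representatives prime by prime, every element of the carrier of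
  \<open>fin_ring\<close> takes this form, and computations reduce to congruences at each
  prime.\<close>

definition cls :: "('a::{finite,field} poly \<Rightarrow> 'a poly) \<Rightarrow> 'a family set" where
  "cls F = fin_class (fam F)"

lemma carrier_resid_prod: "carrier resid_prod = range fam"
proof (intro equalityI subsetI)
  fix f :: "'a family" assume f: "f \<in> carrier resid_prod"
  then have "\<forall>P\<in>monic_primes. \<exists>a. f P = resid P a"
    by (auto simp: resid_prod_def prod_ring_simps carrier_resid_ring)
  then obtain F where "\<And>P. P \<in> monic_primes \<Longrightarrow> f P = resid P (F P)"
    by metis
  then have "f = fam F"
    using f by (auto simp: fam_def resid_prod_def prod_ring_simps PiE_iff extensional_def fun_eq_iff)
  then show "f \<in> range fam"
    by blast
qed (auto simp: fam_def resid_prod_def prod_ring_simps)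

lemma fam_closed [simp]: "fam F \<in> carrier resid_prod"
  by (simp add: carrier_resid_prod)

lemma fam_add: "fam F \<oplus>\<^bsub>resid_prod\<^esub> fam G = fam (\<lambda>P. F P + G P)"
  by (auto simp: resid_prod_def prod_ring_simps fam_def resid_add intro!: restrict_ext)

lemma fam_mult: "fam F \<otimes>\<^bsub>resid_prod\<^esub> fam G = fam (\<lambda>P. F P * G P)"
  by (auto simp: resid_prod_def prod_ring_simps fam_def resid_mult intro!: restrict_ext)

lemma fam_zero: "\<zero>\<^bsub>resid_prod\<^esub> = fam (\<lambda>_. 0)"
  by (auto simp: resid_prod_def prod_ring_simps fam_def resid_zero intro!: restrict_ext)

lemma fam_one: "\<one>\<^bsub>resid_prod\<^esub> = fam (\<lambda>_. 1)"
  by (auto simp: resid_prod_def prod_ring_simps fam_def resid_one intro!: restrict_ext)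

lemma fam_in_resid_sum_iff: "fam F \<in> resid_sum \<longleftrightarrow> finite {P \<in> monic_primes. \<not> P dvd F P}"
proof -
  have "{P \<in> monic_primes. fam F P \<noteq> \<zero>\<^bsub>resid_ring P\<^esub>} = {P \<in> monic_primes. \<not> P dvd F P}"
    by (auto simp: fam_def resid_zero resid_eq_iff cong_0_iff)
  then show ?thesis
    using fam_closed[of F] by (simp add: resid_sum_def direct_sum_def resid_prod_def)
qed

lemma mem_cls_iff:
  "f \<in> cls F \<longleftrightarrow> (\<exists>G. f = fam G \<and> finite {P \<in> monic_primes. \<not> [G P = F P] (mod P)})"
proof
  assume "f \<in> cls F"
  then obtain h where h: "h \<in> resid_sum" "f = h \<oplus>\<^bsub>resid_prod\<^esub> fam F"
    by (auto simp: cls_def fin_class_def a_r_coset_def')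
  then have "h \<in> carrier resid_prod"
    by (simp add: resid_sum_def direct_sum_def resid_prod_def)
  then obtain H where "h = fam H"
    by (auto simp: carrier_resid_prod)
  with h show "\<exists>G. f = fam G \<and> finite {P \<in> monic_primes. \<not> [G P = F P] (mod P)}"
    by (intro exI[of _ "\<lambda>P. H P + F P"])
       (simp add: fam_add fam_in_resid_sum_iff cong_iff_dvd_diff)
next
  assume "\<exists>G. f = fam G \<and> finite {P \<in> monic_primes. \<not> [G P = F P] (mod P)}"
  then obtain G where G: "f = fam G" "finite {P \<in> monic_primes. \<not> [G P = F P] (mod P)}"
    by blast
  then have "fam (\<lambda>P. G P - F P) \<in> resid_sum"
    by (simp add: fam_in_resid_sum_iff cong_iff_dvd_diff)
  moreover have "f = fam (\<lambda>P. G P - F P) \<oplus>\<^bsub>resid_prod\<^esub> fam F"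
    by (simp add: G fam_add)
  ultimately show "f \<in> cls F"
    by (auto simp: cls_def fin_class_def a_r_coset_def')
qed

lemma fam_in_cls: "fam F \<in> cls F"
  by (auto simp: mem_cls_iff)

lemma cls_eqI:
  assumes "finite {P \<in> monic_primes. \<not> [F P = G P] (mod P)}"
  shows "cls F = cls G"
proof -
  have sub: "cls F \<subseteq> cls G" if fin: "finite {P \<in> monic_primes. \<not> [F P = G P] (mod P)}" for F G :: "'a poly \<Rightarrow> 'a poly"
  proof
    fix f assume "f \<in> cls F"
    then obtain E where E: "f = fam E" "finite {P \<in> monic_primes. \<not> [E P = F P] (mod P)}"
      by (auto simp: mem_cls_iff)
    have "{P \<in> monic_primes. \<not> [E P = G P] (mod P)} \<subseteq> {P \<in> monic_primes. \<not> [E P = F P] (mod P)}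
        \<union> {P \<in> monic_primes. \<not> [F P = G P] (mod P)}"
      by (auto dest: cong_trans)
    then have "finite {P \<in> monic_primes. \<not> [E P = G P] (mod P)}"
      using E(2) fin by (meson finite_UnI finite_subset)
    with E(1) show "f \<in> cls G"
      by (auto simp: mem_cls_iff)
  qed
  show ?thesis
    using sub[of F G] sub[of G F] assms by (simp add: cong_sym_eq)
qed

lemma cls_closed [simp]: "cls F \<in> carrier fin_ring"
  by (simp add: cls_def ring_hom_closed[OF fin_class_ring_hom])

lemma cls_add: "cls F \<oplus>\<^bsub>fin_ring\<^esub> cls G = cls (\<lambda>P. F P + G P)"
  by (simp add: cls_def flip: ring_hom_add[OF fin_class_ring_hom] fam_add)

lemma cls_mult: "cls F \<otimes>\<^bsub>fin_ring\<^esub> cls G = cls (\<lambda>P. F P * G P)"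
  by (simp add: cls_def flip: ring_hom_mult[OF fin_class_ring_hom] fam_mult)

lemma cls_zero: "\<zero>\<^bsub>fin_ring\<^esub> = cls (\<lambda>_. 0)"
  by (simp add: cls_def flip: ring_hom_cring.hom_zero[OF fin_class_ring_hom_cring] fam_zero)

lemma cls_one: "\<one>\<^bsub>fin_ring\<^esub> = cls (\<lambda>_. 1)"
  by (simp add: cls_def flip: ring_hom_one[OF fin_class_ring_hom] fam_one)

lemma cls_finsum: "(\<Oplus>\<^bsub>fin_ring\<^esub>x\<in>A. cls (F x)) = cls (\<lambda>P. \<Sum>x\<in>A. F x P)"
proof (induction A rule: infinite_finite_induct)
  case (insert x A)
  then show ?case
    by (subst fin_ring.finsum_insert) (auto simp: cls_add)
qed (auto simp: fin_ring.finsum_infinite cls_zero)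

lemma cls_finprod: "(\<Otimes>\<^bsub>fin_ring\<^esub>x\<in>A. cls (F x)) = cls (\<lambda>P. \<Prod>x\<in>A. F x P)"
proof (induction A rule: infinite_finite_induct)
  case (insert x A)
  then show ?case
    by (subst fin_ring.finprod_insert) (auto simp: cls_mult)
qed (auto simp: fin_ring.finprod_infinite cls_one)

lemma fin_diag_eq_cls: "fin_diag a = cls (\<lambda>_. a)"
  by (simp add: fin_diag_def cls_def fam_def)

text \<open>Only finitely many primes divide \<open>a\<close>; at all others \<open>pinv P a\<close>
  is an inverse.\<close>

lemma cls_const_in_Units:
  assumes "a \<noteq> 0"
  shows "cls (\<lambda>_. a) \<in> Units fin_ring"
proof -
  have "cls (\<lambda>P. a * pinv P a) = cls (\<lambda>_. 1)"
    by (rule cls_eqI, rule finite_subset[OF _ finite_monic_primes_dvd[OF assms]])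
       (auto intro: cong_mult_pinv)
  then have "cls (\<lambda>_. a) \<otimes>\<^bsub>fin_ring\<^esub> cls (\<lambda>P. pinv P a) \<in> Units fin_ring"
    by (simp add: cls_mult flip: cls_one)
  then show ?thesis
    by (rule fin_ring.unit_factor) simp_all
qed

section \<open>Zeta values, polylogarithms and the embedding on representatives\<close>

text \<open>All degrees are below that of \<open>P\<close>, so the denominators are invertible and
  the inverse in the residue ring is given by \<open>pinv\<close>.\<close>

lemma fin_zeta_comp_eq:
  assumes P: "P \<in> monic_primes"
  shows "fin_zeta_comp s \<epsilon> P = resid P (zeta_rep s \<epsilon> P)"
proof -
  let ?r = "length s"
  have "(\<Otimes>\<^bsub>resid_ring P\<^esub>i\<in>{..<?r}. resid P [:\<epsilon> ! i:] [^]\<^bsub>resid_ring P\<^esub> degree (as ! i))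
        \<otimes>\<^bsub>resid_ring P\<^esub> inv\<^bsub>resid_ring P\<^esub> (\<Otimes>\<^bsub>resid_ring P\<^esub>i\<in>{..<?r}. resid P (as ! i) [^]\<^bsub>resid_ring P\<^esub> (s ! i))
      = resid P ((\<Prod>i<?r. [:\<epsilon> ! i:] ^ degree (as ! i)) * pinv P (\<Prod>i<?r. (as ! i) ^ (s ! i)))"
    if as: "as \<in> monic_lists ?r (degree P)" for as
  proof -
    have "\<not> P dvd as ! i" if "i < ?r" for i
    proof (rule monics_not_dvd)
      have "as ! i \<in> set as"
        using as that by (simp add: monic_lists_def)
      with as show "as ! i \<in> monics (degree (as ! i))" "degree (as ! i) < degree P"
        by (auto simp: monic_lists_def monics_def)
    qed
    then have "\<not> P dvd (\<Prod>i<?r. (as ! i) ^ (s ! i))"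
      by (intro not_dvd_prod_power P) auto
    then show ?thesis
      by (simp add: resid_power resid_finprod resid_inv P resid_mult)
  qed
  then have "fin_zeta_comp s \<epsilon> P = (\<Oplus>\<^bsub>resid_ring P\<^esub>as\<in>monic_lists ?r (degree P).
      resid P ((\<Prod>i<?r. [:\<epsilon> ! i:] ^ degree (as ! i)) * pinv P (\<Prod>i<?r. (as ! i) ^ (s ! i))))"
    unfolding fin_zeta_comp_def Let_def monic_lists_def[symmetric]
    by (intro resid_ring.finsum_cong') auto
  then show ?thesis
    by (simp add: resid_finsum zeta_rep_def)
qed

lemma fin_zeta_eq_cls: "fin_zeta s \<epsilon> = cls (zeta_rep s \<epsilon>)"
  by (simp add: fin_zeta_def cls_def fam_def fin_zeta_comp_eq cong: restrict_cong)

context finite_field_ext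
begin

lemma fin_Li_comp_eq:
  assumes Q: "Q \<in> monic_primes"
  shows "fin_Li_comp inc s Q (map (\<lambda>i. resid Q (x i)) [0..<length s]) = resid Q (Li_rep inc s Q x)"
proof -
  let ?r = "length s"
  have "(\<Otimes>\<^bsub>resid_ring Q\<^esub>i\<in>{..<?r}. map (\<lambda>i. resid Q (x i)) [0..<?r] ! i [^]\<^bsub>resid_ring Q\<^esub> (CARD('a) ^ (d ! i)))
        \<otimes>\<^bsub>resid_ring Q\<^esub> inv\<^bsub>resid_ring Q\<^esub> (\<Otimes>\<^bsub>resid_ring Q\<^esub>i\<in>{..<?r}.
               resid Q (map_poly inc (carlitz_L (d ! i))) [^]\<^bsub>resid_ring Q\<^esub> (s ! i))
      = resid Q ((\<Prod>i<?r. x i ^ (CARD('a) ^ (d ! i)))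
           * pinv Q (\<Prod>i<?r. map_poly inc (carlitz_L (d ! i)) ^ (s ! i)))"
    if d: "d \<in> decreasing_lists ?r (degree (below inc Q))" for d
  proof -
    have "\<not> Q dvd map_poly inc (carlitz_L (d ! i))" if "i < ?r" for i
      using decreasing_lists_nth_less[OF d that] below_monic_primes[OF Q]
      by (simp add: dvd_map_poly_inc_iff_below Q carlitz_L_not_dvd)
    then have "\<not> Q dvd (\<Prod>i<?r. map_poly inc (carlitz_L (d ! i)) ^ (s ! i))"
      by (intro not_dvd_prod_power Q) auto
    moreover have "(\<Otimes>\<^bsub>resid_ring Q\<^esub>i\<in>{..<?r}. map (\<lambda>i. resid Q (x i)) [0..<?r] ! i [^]\<^bsub>resid_ring Q\<^esub> (CARD('a) ^ (d ! i)))
        = resid Q (\<Prod>i<?r. x i ^ (CARD('a) ^ (d ! i)))"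
      unfolding resid_finprod[symmetric]
      by (intro resid_ring.finprod_cong') (auto simp: resid_power)
    ultimately show ?thesis
      by (simp add: resid_power resid_finprod resid_inv Q resid_mult)
  qed
  then have "fin_Li_comp inc s Q (map (\<lambda>i. resid Q (x i)) [0..<?r])
    = (\<Oplus>\<^bsub>resid_ring Q\<^esub>d\<in>decreasing_lists ?r (degree (below inc Q)).
        resid Q ((\<Prod>i<?r. x i ^ (CARD('a) ^ (d ! i)))
           * pinv Q (\<Prod>i<?r. map_poly inc (carlitz_L (d ! i)) ^ (s ! i))))"
    unfolding fin_Li_comp_def Let_def decreasing_lists_def[symmetric]
    by (intro resid_ring.finsum_cong') auto
  then show ?thesis
    by (simp add: resid_finsum Li_rep_def)
qed

lemma cong_Li_rep:
  assumes "\<And>i. i < length s \<Longrightarrow> [x i = y i] (mod Q)"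
  shows "[Li_rep inc s Q x = Li_rep inc s Q y] (mod Q)"
  unfolding Li_rep_def using assms by (intro cong_sum cong_mult cong_prod cong_pow cong_refl) auto

text \<open>A change of representing families alters each of the finitely many arguments at finitely
  many \<open>Q\<close> only, so the class of the value does not depend on the choice.\<close>

lemma fin_Li_eq_cls:
  "fin_Li inc s (map (\<lambda>i. cls (F i)) [0..<length s]) = cls (\<lambda>Q. Li_rep inc s Q (\<lambda>i. F i Q))"
proof -
  let ?r = "length s"
  let ?B = "map (\<lambda>i. cls (F i)) [0..<?r]"
  let ?v = "\<lambda>f. fin_class (\<lambda>Q\<in>monic_primes. fin_Li_comp inc s Q (map (\<lambda>g. g Q) f))"
  have "?v f = cls (\<lambda>Q. Li_rep inc s Q (\<lambda>i. F i Q))" if f: "list_all2 (\<in>) f ?B" for f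
  proof -
    have len: "length f = ?r"
      using f by (simp add: list_all2_lengthD)
    then have "\<forall>i<?r. \<exists>G. f ! i = fam G \<and> finite {Q \<in> monic_primes. \<not> [G Q = F i Q] (mod Q)}"
      using f by (auto simp: list_all2_conv_all_nth mem_cls_iff)
    then obtain G where "\<forall>i<?r. f ! i = fam (G i) \<and> finite {Q \<in> monic_primes. \<not> [G i Q = F i Q] (mod Q)}"
      unfolding choice_iff' by blast
    then have G: "\<And>i. i < ?r \<Longrightarrow> f ! i = fam (G i)"
      "\<And>i. i < ?r \<Longrightarrow> finite {Q \<in> monic_primes. \<not> [G i Q = F i Q] (mod Q)}"
      by simp_all
    have "map (\<lambda>g. g Q) f = map (\<lambda>i. resid Q (G i Q)) [0..<?r]" if "Q \<in> monic_primes" for Q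
      using that by (intro nth_equalityI) (auto simp: len G(1) fam_def)
    then have "?v f = cls (\<lambda>Q. Li_rep inc s Q (\<lambda>i. G i Q))"
      by (simp add: cls_def fam_def fin_Li_comp_eq cong: restrict_cong)
    also have "\<dots> = cls (\<lambda>Q. Li_rep inc s Q (\<lambda>i. F i Q))"
    proof (rule cls_eqI, rule finite_subset)
      show "{Q \<in> monic_primes. \<not> [Li_rep inc s Q (\<lambda>i. G i Q) = Li_rep inc s Q (\<lambda>i. F i Q)] (mod Q)}
          \<subseteq> (\<Union>i<?r. {Q \<in> monic_primes. \<not> [G i Q = F i Q] (mod Q)})"
        using cong_Li_rep[of s "\<lambda>i. G i _" "\<lambda>i. F i _"] by blast
    qed (use G(2) in auto)
    finally show ?thesis .
  qed
  \<comment> \<open>Some choice of representatives exists, so the set of values is a singleton and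
    not empty.\<close>
  moreover have "list_all2 (\<in>) (map (\<lambda>i. fam (F i)) [0..<?r]) ?B"
    by (auto simp: list_all2_conv_all_nth fam_in_cls)
  ultimately have "?v ` {f. list_all2 (\<in>) f ?B} = {cls (\<lambda>Q. Li_rep inc s Q (\<lambda>i. F i Q))}"
    by (intro equalityI subsetI) (force simp del: map_map)+
  then show ?thesis
    by (simp add: fin_Li_def)
qed

text \<open>Polynomials congruent modulo the prime below have congruent images modulo
  \<open>Q\<close>, so the set of values on a coset is a singleton.\<close>

lemma resid_embed_resid:
  assumes Q: "Q \<in> monic_primes"
  shows "resid_embed inc Q (resid (below inc Q) a) = resid Q (map_poly inc a)"
proof -
  have "(\<lambda>b. resid Q (map_poly inc b)) ` resid (below inc Q) a
      = (\<lambda>_. resid Q (map_poly inc a)) ` resid (below inc Q) a"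
    using cong_map_poly_inc[OF Q] by (intro image_cong refl) (simp add: mem_resid_iff resid_eq_iff)
  also have "\<dots> = {resid Q (map_poly inc a)}"
  proof (rule image_constant)
    show "a \<in> resid (below inc Q) a"
      by (simp add: mem_resid_iff)
  qed
  finally show ?thesis
    by (simp add: resid_embed_def)
qed

text \<open>Two representing families differ at finitely many \<open>P\<close>, and only finitely
  many \<open>Q\<close> lie above each of them.\<close>

lemma fin_embed_cls: "fin_embed inc (cls F) = cls (\<lambda>Q. map_poly inc (F (below inc Q)))"
proof -
  let ?v = "\<lambda>f. fin_class (\<lambda>Q\<in>monic_primes. resid_embed inc Q (f (below inc Q)))"
  have "?v f = cls (\<lambda>Q. map_poly inc (F (below inc Q)))" if f: "f \<in> cls F" for f
  proof -
    obtain G where G: "f = fam G" "finite {P \<in> monic_primes. \<not> [G P = F P] (mod P)}"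
      using f by (auto simp: mem_cls_iff)
    have "?v f = cls (\<lambda>Q. map_poly inc (G (below inc Q)))"
      using below_monic_primes
      by (simp add: cls_def fam_def G(1) resid_embed_resid cong: restrict_cong)
    also have "\<dots> = cls (\<lambda>Q. map_poly inc (F (below inc Q)))"
    proof (rule cls_eqI, rule finite_subset)
      show "{Q \<in> monic_primes. \<not> [map_poly inc (G (below inc Q)) = map_poly inc (F (below inc Q))] (mod Q)}
          \<subseteq> (\<Union>P\<in>{P \<in> monic_primes. \<not> [G P = F P] (mod P)}. {Q \<in> monic_primes. below inc Q = P})"
        using cong_map_poly_inc below_monic_primes by blast
    qed (use G(2) finite_below_eq in auto)
    finally show ?thesis .
  qed
  then have "?v ` cls F = {cls (\<lambda>Q. map_poly inc (F (below inc Q)))}"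
    using fam_in_cls[of F] by blast
  then show ?thesis
    by (simp add: fin_embed_def)
qed

end

lemma carlitz_Gamma_neq_0 [simp]: "carlitz_Gamma n \<noteq> 0"
  by (simp add: carlitz_Gamma_def)

section \<open>The identity of classes over the larger field\<close>

theorem theorem3p9:
  fixes inc :: "'a::{finite,field} \<Rightarrow> 'b::{finite,field}"
    and s :: "nat list" and \<epsilon> :: "'a list" and \<gamma> :: "'b poly list" and r :: nat
    and RHS :: "'b family set"
  assumes "inc \<in> ring_hom ring_of_type_algebra ring_of_type_algebra"
    and "CARD('b) = CARD('a) ^ (CARD('a) - 1)"
    and "r \<ge> 1"
    and "length s = r" and "\<forall>i<r. s ! i \<ge> 1"
    and "length \<epsilon> = r" and "\<forall>i<r. \<epsilon> ! i \<noteq> 0"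
    and "length \<gamma> = r" and "\<forall>i<r. is_unit (\<gamma> ! i)"
    and "\<forall>i<r. (\<gamma> ! i) ^ (CARD('a) - 1) = [:inc (\<epsilon> ! i):]"
  defines "RHS \<equiv>
      inv\<^bsub>fin_ring\<^esub> (\<Otimes>\<^bsub>fin_ring\<^esub>i\<in>{..<r}.
          fin_diag (\<gamma> ! i) \<otimes>\<^bsub>fin_ring\<^esub> fin_diag (map_poly inc (carlitz_Gamma (s ! i))))
      \<otimes>\<^bsub>fin_ring\<^esub>
      (\<Oplus>\<^bsub>fin_ring\<^esub>j\<in>AT_J TYPE('a) s.
          fin_diag (theta ^ sum_list j) \<otimes>\<^bsub>fin_ring\<^esub>
          fin_Li inc s (map (\<lambda>i. fin_diag (\<gamma> ! i * map_poly inc (AT_u (s ! i) (j ! i)))) [0..<r]))"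
  shows "fin_embed inc (fin_zeta s \<epsilon>) = RHS \<and> RHS \<in> fin_embed inc ` carrier fin_ring"
proof -
  have hom: "inc (x + y) = inc x + inc y" "inc (x * y) = inc x * inc y" "inc 1 = 1" for x y
    using assms(1) by (auto simp: ring_hom_def ring_of_type_algebra_def)
  moreover have "inc 0 = 0"
    using hom(1)[of 0 0] by (metis add.right_neutral add_left_cancel)
  ultimately interpret finite_field_ext inc
    by unfold_locales auto
  note r = \<open>length s = r\<close>
  \<comment> \<open>The common denominator of the right-hand side; it is a nonzero constant family
    and hence a unit.\<close>
  define W where "W = (\<Prod>i<r. \<gamma> ! i * map_poly inc (carlitz_Gamma (s ! i)))"
  define Z where "Z = (\<lambda>Q. map_poly inc (zeta_rep s \<epsilon> (below inc Q)))"
  have "\<gamma> ! i \<noteq> 0" if "i < r" for i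
    using assms(9) that by fastforce
  then have "W \<noteq> 0"
    by (auto simp: W_def)
  then have unit: "cls (\<lambda>_. W) \<in> Units fin_ring"
    by (rule cls_const_in_Units)
  have "RHS = inv\<^bsub>fin_ring\<^esub> cls (\<lambda>_. W) \<otimes>\<^bsub>fin_ring\<^esub> cls (\<lambda>Q. \<Sum>j\<in>AT_J TYPE('a) s. theta ^ sum_list j
      * Li_rep inc s Q (\<lambda>i. \<gamma> ! i * map_poly inc (AT_u (s ! i) (j ! i))))"
    unfolding RHS_def fin_diag_eq_cls r[symmetric] fin_Li_eq_cls cls_mult cls_finprod cls_finsum
    by (simp add: W_def r)
  \<comment> \<open>With \<open>W\<close> multiplied to the zeta side the congruence holds at every
    \<open>Q\<close>, so the exceptional set is empty.\<close>
  also have "cls (\<lambda>Q. \<Sum>j\<in>AT_J TYPE('a) s. theta ^ sum_list j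
      * Li_rep inc s Q (\<lambda>i. \<gamma> ! i * map_poly inc (AT_u (s ! i) (j ! i)))) = cls (\<lambda>Q. W * Z Q)"
  proof (rule cls_eqI)
    have "[(\<Sum>j\<in>AT_J TYPE('a) s. theta ^ sum_list j
      * Li_rep inc s Q (\<lambda>i. \<gamma> ! i * map_poly inc (AT_u (s ! i) (j ! i)))) = W * Z Q] (mod Q)"
      if "Q \<in> monic_primes" for Q
      unfolding W_def Z_def r[symmetric] using that assms by (intro cong_sym[OF cong_zeta_rep]) auto
    then have "{Q \<in> monic_primes. \<not> [\<Sum>j\<in>AT_J TYPE('a) s. theta ^ sum_list j
      * Li_rep inc s Q (\<lambda>i. \<gamma> ! i * map_poly inc (AT_u (s ! i) (j ! i))) = W * Z Q] (mod Q)} = {}"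
      by blast
    then show "finite {Q \<in> monic_primes. \<not> [\<Sum>j\<in>AT_J TYPE('a) s. theta ^ sum_list j
      * Li_rep inc s Q (\<lambda>i. \<gamma> ! i * map_poly inc (AT_u (s ! i) (j ! i))) = W * Z Q] (mod Q)}"
      by (simp only: finite.emptyI)
  qed
  also have "\<dots> = cls (\<lambda>_. W) \<otimes>\<^bsub>fin_ring\<^esub> cls Z"
    by (simp add: cls_mult)
  also have "inv\<^bsub>fin_ring\<^esub> cls (\<lambda>_. W) \<otimes>\<^bsub>fin_ring\<^esub> (cls (\<lambda>_. W) \<otimes>\<^bsub>fin_ring\<^esub> cls Z) = cls Z"
    using unit by (simp add: fin_ring.m_assoc[symmetric])
  also have "cls Z = fin_embed inc (fin_zeta s \<epsilon>)"
    by (simp add: fin_zeta_eq_cls fin_embed_cls Z_def)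
  finally have "RHS = fin_embed inc (fin_zeta s \<epsilon>)" .
  \<comment> \<open>Together with the identity this places the right-hand side in the image of the
    embedding.\<close>
  moreover have "fin_zeta s \<epsilon> \<in> carrier fin_ring"
    by (simp add: fin_zeta_eq_cls)
  ultimately show ?thesis
    by blast
qed

end
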